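(* Let $f(\boldsymbol{x})=\frac12\boldsymbol{x}^\top\boldsymbol{A}\boldsymbol{x}-\boldsymbol{b}^\top\boldsymbol{x}$ on $\mathbb{R}^d$, where $\boldsymbol{b}\in\mathbb{R}^d$ and $\boldsymbol{A}$ is symmetric with $\mu\boldsymbol{I}_d\preceq\boldsymbol{A}\preceq L\boldsymbol{I}_d$, $L,\mu>0$. Consider the greedy or random SR1 or BFGS method for quadratic minimization (described in the context), started from $\boldsymbol{x}_0\in\mathbb{R}^d$ and a random symmetric $\boldsymbol{G}_0$ such that $\boldsymbol{G}_0\succeq\boldsymbol{A}$ always holds, with $\mathbb{E}\,\mathrm{tr}(\boldsymbol{G}_0)<\infty$. Let $\tau_0=\mathrm{tr}(\boldsymbol{G}_0-\boldsymbol{A})$ and $\sigma_0=\mathrm{tr}(\boldsymbol{G}_0\boldsymbol{A}^{-1})-d$. Then for all $k\ge 0$ we have $\lambda_{k+1}\le\rho_k\lambda_k$, where $\rho_k$ is a certain nonnegative random variable such that: for the (greedy or random) SR1 update, $$\mathbb{E}\,\rho_k\le\left(1-\frac kd\right)_+\frac{\mathbb{E}\,\tau_0}{\mu},\qquad\forall k\ge 0,$$ and for the (greedy or random) BFGS update, $$\mathbb{E}\,\rho_k\le\left(1-\frac1d\right)^k\mathbb{E}\,\sigma_0,\qquad\forall k\ge 0.$$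
   Context: $\preceq$ is the Loewner order; $(x)_+=\max\{x,0\}$; $\boldsymbol{e}_1,\dots,\boldsymbol{e}_d$ are the standard basis vectors; $\mathrm{Unif}(\mathcal{S}^{d-1})$ is the uniform distribution on the unit sphere. $\lambda_k=\sqrt{\nabla f(\boldsymbol{x}_k)^\top\boldsymbol{A}^{-1}\nabla f(\boldsymbol{x}_k)}$. For symmetric $\boldsymbol{G}\succeq\boldsymbol{A}\succ0$: $\mathrm{SR1}(\boldsymbol{G},\boldsymbol{A},\boldsymbol{u})=\boldsymbol{G}$ if $\boldsymbol{G}\boldsymbol{u}=\boldsymbol{A}\boldsymbol{u}$, otherwise $\boldsymbol{G}-\frac{(\boldsymbol{G}-\boldsymbol{A})\boldsymbol{u}\boldsymbol{u}^\top(\boldsymbol{G}-\boldsymbol{A})}{\boldsymbol{u}^\top(\boldsymbol{G}-\boldsymbol{A})\boldsymbol{u}}$; and, for $\boldsymbol{u}\neq\boldsymbol{0}$, $\mathrm{BFGS}(\boldsymbol{G},\boldsymbol{A},\boldsymbol{u})=\boldsymbol{G}-\frac{\boldsymbol{G}\boldsymbol{u}\boldsymbol{u}^\top\boldsymbol{G}}{\boldsymbol{u}^\top\boldsymbol{G}\boldsymbol{u}}+\frac{\boldsymbol{A}\boldsymbol{u}\boldsymbol{u}^\top\boldsymbol{A}}{\boldsymbol{u}^\top\boldsymbol{A}\boldsymbol{u}}$. Method: given $\boldsymbol{x}_0$, $\boldsymbol{G}_0\succeq\boldsymbol{A}$ and a square matrix $\boldsymbol{L}_0$ with $\boldsymbol{L}_0^\top\boldsymbol{L}_0=\boldsymbol{G}_0^{-1}$,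 for each $k\ge0$ set $\boldsymbol{x}_{k+1}=\boldsymbol{x}_k-\boldsymbol{G}_k^{-1}\nabla f(\boldsymbol{x}_k)$ and then use one fixed rule among the following. - SR1: $\boldsymbol{G}_{k+1}=\mathrm{SR1}(\boldsymbol{G}_k,\boldsymbol{A},\boldsymbol{u}_k)$ with, for the greedy method, $\boldsymbol{u}_k\in\arg\max_{\boldsymbol{u}\in\{\boldsymbol{e}_1,\dots,\boldsymbol{e}_d\}}\boldsymbol{u}^\top(\boldsymbol{G}_k-\boldsymbol{A})\boldsymbol{u}$, or, for the random method, $\boldsymbol{u}_k\sim\mathrm{Unif}(\mathcal{S}^{d-1})$ independent of the past. - BFGS: $\boldsymbol{G}_{k+1}=\mathrm{BFGS}(\boldsymbol{G}_k,\boldsymbol{A},\boldsymbol{u}_k)$ with $\boldsymbol{u}_k=\boldsymbol{L}_k^\top\tilde{\boldsymbol{u}}_k$, where, for the greedy method, $\tilde{\boldsymbol{u}}_k\in\arg\max_{\tilde{\boldsymbol{u}}\in\{\boldsymbol{e}_1,\dots,\boldsymbol{e}_d\}}\tilde{\boldsymbol{u}}^\top\boldsymbol{L}_k^{-\top}\boldsymbol{A}^{-1}\boldsymbol{L}_k^{-1}\tilde{\boldsymbol{u}}$, or, for the random method, $\tilde{\boldsymbol{u}}_k\sim\mathrm{Unif}(\mathcal{S}^{d-1})$ independent of the past; and $\boldsymbol{L}_{k+1}=\boldsymbol{L}_k-\frac{[\boldsymbol{L}_k\boldsymbol{A}\boldsymbol{u}_k-\boldsymbol{v}_k]\boldsymbol{u}_k^\top}{\boldsymbol{u}_k^\top\boldsymbol{A}\boldsymbol{u}_k}$,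 $\boldsymbol{v}_k=\sqrt{\boldsymbol{u}_k^\top\boldsymbol{A}\boldsymbol{u}_k}\frac{\tilde{\boldsymbol{u}}_k}{\|\tilde{\boldsymbol{u}}_k\|}$, which satisfies $\boldsymbol{L}_{k+1}^\top\boldsymbol{L}_{k+1}=\boldsymbol{G}_{k+1}^{-1}$. Ties in the arg max are broken arbitrarily. Expectations are over $\boldsymbol{G}_0$ and the directions (greedy directions carry no randomness of their own). *)

theory Defs
  imports "HOL-Probability.Probability"
begin

definition psd :: "real^'n^'n \<Rightarrow> bool" where
  "psd X \<longleftrightarrow> transpose X = X \<and> (\<forall>v. 0 \<le> v \<bullet> (X *v v))"

definition loewner_le :: "real^'n^'n \<Rightarrow> real^'n^'n \<Rightarrow> bool"  (infix "\<preceq>" 50) where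
  "X \<preceq> Y \<longleftrightarrow> psd (Y - X)"

definition outer :: "real^'n \<Rightarrow> real^'n \<Rightarrow> real^'n^'n" where
  "outer u v = (\<chi> i j. u $ i * v $ j)"

definition gradient :: "('a::real_inner \<Rightarrow> real) \<Rightarrow> 'a \<Rightarrow> 'a" where
  "gradient f x = (THE g. GDERIV f x :> g)"

definition quadratic :: "real^'n^'n \<Rightarrow> real^'n \<Rightarrow> real^'n \<Rightarrow> real" where
  "quadratic A b x = 1/2 * (x \<bullet> (A *v x)) - b \<bullet> x"

definition newton_decrement :: "(real^'n \<Rightarrow> real) \<Rightarrow> real^'n^'n \<Rightarrow> real^'n \<Rightarrow> real" where
  "newton_decrement f A x = sqrt (gradient f x \<bullet> (matrix_inv A *v gradient f x))"

definition SR1 :: "real^'n^'n \<Rightarrow> real^'n^'n \<Rightarrow> real^'n \<Rightarrow> real^'n^'n" where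
  "SR1 G A u = (if G *v u = A *v u then G
     else G - ((G - A) ** outer u u ** (G - A)) /\<^sub>R (u \<bullet> ((G - A) *v u)))"

text \<open>Only meant for \<open>u \<noteq> 0\<close>; since \<open>inverse 0 = 0\<close>, the value at \<open>u = 0\<close> is \<open>G\<close>.\<close>

definition BFGS :: "real^'n^'n \<Rightarrow> real^'n^'n \<Rightarrow> real^'n \<Rightarrow> real^'n^'n" where
  "BFGS G A u = G - (G ** outer u u ** G) /\<^sub>R (u \<bullet> (G *v u))
                  + (A ** outer u u ** A) /\<^sub>R (u \<bullet> (A *v u))"

text \<open>The update of the factor \<open>K\<close> with \<open>transpose K ** K = matrix_inv G\<close>
  that accompanies \<open>BFGS\<close> in the direction \<open>u = transpose K *v w\<close>.\<close>

definition BFGS_factor ::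
  "real^'n^'n \<Rightarrow> real^'n^'n \<Rightarrow> real^'n \<Rightarrow> real^'n \<Rightarrow> real^'n^'n" where
  "BFGS_factor K A u w =
     (let v = (sqrt (u \<bullet> (A *v u)) / norm w) *\<^sub>R w
      in K - outer (K *v (A *v u) - v) u /\<^sub>R (u \<bullet> (A *v u)))"

text \<open>Runs of the two methods along a single realisation of the directions. Neither predicate
  restricts how the directions \<open>u\<close>, resp. \<open>w\<close>, are chosen.\<close>

definition SR1_run :: "(real^'n \<Rightarrow> real) \<Rightarrow> real^'n^'n \<Rightarrow> real^'n \<Rightarrow>
    (nat \<Rightarrow> real^'n) \<Rightarrow> (nat \<Rightarrow> real^'n^'n) \<Rightarrow> (nat \<Rightarrow> real^'n) \<Rightarrow> bool" where
  "SR1_run f A x0 x G u \<longleftrightarrow> x 0 = x0 \<and>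
     (\<forall>k. x (Suc k) = x k - matrix_inv (G k) *v gradient f (x k) \<and>
          G (Suc k) = SR1 (G k) A (u k))"

definition BFGS_run :: "(real^'n \<Rightarrow> real) \<Rightarrow> real^'n^'n \<Rightarrow> real^'n \<Rightarrow>
    (nat \<Rightarrow> real^'n) \<Rightarrow> (nat \<Rightarrow> real^'n^'n) \<Rightarrow> (nat \<Rightarrow> real^'n^'n) \<Rightarrow>
    (nat \<Rightarrow> real^'n) \<Rightarrow> (nat \<Rightarrow> real^'n) \<Rightarrow> bool" where
  "BFGS_run f A x0 x G K u w \<longleftrightarrow> x 0 = x0 \<and> transpose (K 0) ** K 0 = matrix_inv (G 0) \<and>
     (\<forall>k. x (Suc k) = x k - matrix_inv (G k) *v gradient f (x k) \<and>
          u k = transpose (K k) *v w k \<and>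
          G (Suc k) = BFGS (G k) A (u k) \<and>
          K (Suc k) = BFGS_factor (K k) A (u k) (w k))"

definition greedy_direction :: "real^'n^'n \<Rightarrow> real^'n \<Rightarrow> bool" where
  "greedy_direction Q u \<longleftrightarrow>
     is_arg_max (\<lambda>v. v \<bullet> (Q *v v)) (\<lambda>v. v \<in> range (\<lambda>i. axis i 1)) u"

text \<open>The normalised surface measure of the unit sphere, as the radial projection of the uniform
  distribution on the unit ball. The lemmas below characterise it: it is the probability measure
  concentrated on the sphere that is invariant under orthogonal transformations (shown for
  well-ordered index types, as in the library's change-of-variables theorems; every finite
  dimension has such an index type).\<close>

definition unif_sphere :: "'a::euclidean_space measure" where
  "unif_sphere = distr (uniform_measure lborel (ball 0 1)) borel (\<lambda>x. x /\<^sub>R norm x)"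

text \<open>\<open>H\<close> is the random initial data. The past at step \<open>k\<close> is generated by \<open>H\<close> and
  \<open>U 0, \<dots>, U (k - 1)\<close>.\<close>

definition random_directions :: "'w measure \<Rightarrow> ('w \<Rightarrow> 'h::topological_space) \<Rightarrow>
    (nat \<Rightarrow> 'w \<Rightarrow> 'a::euclidean_space) \<Rightarrow> bool" where
  "random_directions M H U \<longleftrightarrow> H \<in> borel_measurable M \<and>
     (\<forall>k. U k \<in> borel_measurable M \<and> distr M borel (U k) = unif_sphere \<and>
        prob_space.indep_set M
          (sets (vimage_algebra (space M) (\<lambda>\<omega>. (H \<omega>, \<lambda>i\<in>{..<k}. U i \<omega>))
                   (borel \<Otimes>\<^sub>M Pi\<^sub>M {..<k} (\<lambda>_. borel))))
          (sets (vimage_algebra (space M) (U k) borel)))"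

lemma gradient_eqI:
  assumes "GDERIV f x :> g"
  shows "gradient f x = g"
  unfolding gradient_def
proof (rule the_equality)
  fix h assume "GDERIV f x :> h"
  then have "(\<lambda>v. v \<bullet> h) = (\<lambda>v. v \<bullet> g)"
    using assms unfolding gderiv_def by (rule has_derivative_unique)
  then show "h = g"
    by (metis vector_eq_ldot)
qed (rule assms)

lemma sets_unif_sphere [simp, measurable_cong]: "sets unif_sphere = sets borel"
  by (simp add: unif_sphere_def)

lemma prob_space_unif_sphere: "prob_space (unif_sphere :: 'a::euclidean_space measure)"
proof -
  have "prob_space (uniform_measure lborel (ball (0::'a) 1))"
    by (rule prob_space_uniform_measure)
      (use emeasure_lborel_ball_finite[of "0::'a" 1] content_ball_pos[of 1 "0::'a"]
        in \<open>auto simp: measure_def\<close>)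
  then show ?thesis
    unfolding unif_sphere_def by (rule prob_space.prob_space_distr) measurable
qed

lemma AE_unif_sphere: "AE u in (unif_sphere :: 'a::euclidean_space measure). norm u = 1"
proof -
  have "AE x in lborel. x \<noteq> (0::'a)"
    by (rule AE_lborel_singleton)
  then have "AE x in uniform_measure lborel (ball (0::'a) 1). x \<noteq> 0"
    by (intro AE_uniform_measureI) auto
  then show ?thesis
    unfolding unif_sphere_def by (subst AE_distr_iff) auto
qed

lemma distr_unif_sphere_orthogonal:
  fixes T :: "real^'n::{finite,wellorder} \<Rightarrow> real^'n::_"
  assumes T: "orthogonal_transformation T"
  shows "distr unif_sphere borel T = unif_sphere"
proof (rule measure_eqI)
  have lin: "linear T" using T by (rule orthogonal_transformation_linear)
  have [measurable]: "T \<in> borel_measurable borel"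
    using lin by (intro borel_measurable_continuous_onI linear_continuous_on linear_conv_bounded_linear[THEN iffD1])
  fix B assume "B \<in> sets (distr unif_sphere borel T)"
  then have [measurable]: "B \<in> sets borel" by simp
  define C where "C = {y. y /\<^sub>R norm y \<in> B}"
  have [measurable]: "C \<in> sets borel" unfolding C_def by measurable
  define S where "S = ball 0 1 \<inter> T -` C"
  have nT: "norm (T x) = norm x" for x by (rule orthogonal_transformation_norm[OF T])
  have meas: "S \<in> sets borel"
    using measurable_sets[of T borel borel C] unfolding S_def by auto
  have lm: "X \<in> lmeasurable" if "X \<in> sets borel" "X \<subseteq> ball 0 1" for X :: "(real^'n::{finite,wellorder}) set"
    using that bounded_subset[OF bounded_ball] by (intro bounded_set_imp_lmeasurable) auto
  have em: "emeasure lborel X = ennreal (measure lebesgue X)"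
    if "X \<in> sets borel" "X \<subseteq> ball 0 1" for X :: "(real^'n::{finite,wellorder}) set"
    using lm[OF that] that
    by (auto simp: fmeasurable_def emeasure_eq_ennreal_measure top.not_eq_extremum)
  have img: "T ` S = ball 0 1 \<inter> C"
  proof -
    have "y \<in> T ` S" if "y \<in> ball 0 1 \<inter> C" for y
    proof -
      obtain x where "y = T x"
        using orthogonal_transformation_surj[OF T] by (metis surjD)
      then show ?thesis using that nT by (auto simp: S_def)
    qed
    then show ?thesis using nT by (auto simp: S_def)
  qed
  have "emeasure lborel S = emeasure lborel (ball 0 1 \<inter> C)"
    using measure_orthogonal_image[OF T lm[OF meas]] em[OF meas] em[of "ball 0 1 \<inter> C"]
    unfolding img by (auto simp: S_def)
  moreover have "ball 0 1 \<inter> (\<lambda>x. T (x /\<^sub>R norm x)) -` B = S"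
    unfolding S_def C_def by (auto simp: nT linear_scale[OF lin])
  moreover have "ball 0 1 \<inter> (\<lambda>x. x /\<^sub>R norm x) -` B = ball 0 1 \<inter> C"
    unfolding C_def by auto
  moreover have "(\<lambda>x. T (x /\<^sub>R norm x)) -` B \<in> sets borel"
    using measurable_sets[of "\<lambda>x. T (x /\<^sub>R norm x)" borel borel B] by simp
  moreover have "(\<lambda>x::real^'n::{finite,wellorder}. x /\<^sub>R norm x) -` B \<in> sets borel"
    using measurable_sets[of "\<lambda>x::real^'n::{finite,wellorder}. x /\<^sub>R norm x" borel borel B] by simp
  ultimately show "emeasure (distr unif_sphere borel T) B = emeasure unif_sphere B"
    unfolding unif_sphere_def
    by (simp add: emeasure_distr distr_distr comp_def)
qed simp

end

theory Submission
  imports Defs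
begin

text \<open>Write \<open>R = G - A\<close>. For quadratic \<open>f\<close> the new gradient is \<open>R G\<^sup>-\<^sup>1 \<nabla>f(x)\<close>, so two
  applications of the Cauchy--Schwarz inequality show that the Newton decrement contracts by any
  \<open>\<rho>\<close> with \<open>R \<preceq> \<rho> A\<close>; both \<open>tr R / \<mu>\<close> and \<open>\<sigma> = tr (G A\<^sup>-\<^sup>1) - d\<close> are such numbers.

  An SR1 update lowers \<open>tr R\<close> by \<open>|R u|\<^sup>2 / (u\<^sup>T R u)\<close>. The greedy choice makes this at least
  \<open>tr R\<close> divided by the number of nonzero columns of \<open>R\<close>, and each step kills a column. For a random
  direction, reflection invariance of the sphere gives the mean lower bound \<open>tr R / rank R\<close>, and each
  step almost surely lowers the rank. Either way the trace loses the fraction \<open>1 / (d - k)\<close> in step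
  \<open>k\<close>, and the product telescopes. A BFGS update changes \<open>\<sigma>\<close> by \<open>1 - w\<^sup>T Q w\<close> where
  \<open>tr Q = \<sigma> + d\<close>, and \<open>w\<^sup>T Q w\<close> is at least (greedy) or on average (random) \<open>tr Q / d\<close>.

  Greedy directions need not be measurable, so in the greedy cases \<open>\<rho>\<^sub>k\<close> is the deterministic
  multiple of the initial value rather than the quantity at step \<open>k\<close>.\<close>

section \<open>Positive semidefinite matrices\<close>

lemma inner_matrix_vector_swap:
  fixes A :: "real^'n^'m"
  shows "x \<bullet> (A *v y) = (transpose A *v x) \<bullet> y"
  by (simp add: dot_lmul_matrix)

text \<open>As a simp rule it would turn \<open>transpose K *v w\<close> into a row-vector product,
  a form that the rules below do not match.\<close>

declare transpose_matrix_vector [simp del]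

lemma outer_mult_vec [simp]: "outer u v *v x = (v \<bullet> x) *\<^sub>R u"
  by (simp add: outer_def matrix_vector_mult_def vec_eq_iff inner_vec_def sum_distrib_left mult_ac)

lemma transpose_outer [simp]: "transpose (outer u v) = outer v u"
  by (simp add: outer_def transpose_def vec_eq_iff mult.commute)

lemma trace_outer [simp]: "trace (outer u v) = u \<bullet> v"
  by (simp add: outer_def trace_def inner_vec_def)

lemma matrix_mul_outer: "X ** outer u v = outer (X *v u) v"
  by (simp add: outer_def matrix_matrix_mult_def matrix_vector_mult_def vec_eq_iff
      sum_distrib_left mult_ac)

lemma outer_matrix_mul: "outer u v ** X = outer u (transpose X *v v)"
  by (simp add: outer_def matrix_matrix_mult_def matrix_vector_mult_def transpose_def vec_eq_iff
      sum_distrib_left mult_ac)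

lemma trace_scaleR: "trace (c *\<^sub>R X) = c * trace (X :: real^'n^'n)"
  by (simp add: trace_def sum_distrib_left)

lemma transpose_scaleR: "transpose (c *\<^sub>R X) = c *\<^sub>R transpose (X :: real^'n^'m)"
  by (simp add: transpose_def vec_eq_iff)

lemma transpose_diff: "transpose (X - Y) = transpose X - transpose (Y :: real^'n^'m)"
  by (simp add: transpose_def vec_eq_iff)

lemma transpose_add: "transpose (X + Y) = transpose X + transpose (Y :: real^'n^'m)"
  by (simp add: transpose_def vec_eq_iff)

lemma matrix_mul_diff_ldistrib: "X ** (Y - Z) = X ** Y - X ** (Z :: real^'n^'m)"
  by (simp add: matrix_eq matrix_vector_mul_assoc[symmetric] matrix_vector_mult_diff_rdistrib
      matrix_vector_mult_diff_distrib)

lemma matrix_mul_scaleR: "X ** (c *\<^sub>R Y) = c *\<^sub>R (X ** (Y :: real^'n^'m))"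
  by (simp add: matrix_eq matrix_vector_mul_assoc[symmetric] scaleR_matrix_vector_assoc[symmetric]
      matrix_vector_mult_scaleR)

lemma psd_transpose: "psd R \<Longrightarrow> transpose R = R"
  and psd_nonneg: "psd R \<Longrightarrow> 0 \<le> v \<bullet> (R *v v)"
  by (auto simp: psd_def)

lemma symmetric_swap:
  fixes R :: "real^'n^'n"
  assumes "transpose R = R"
  shows "x \<bullet> (R *v y) = (R *v x) \<bullet> y"
  using inner_matrix_vector_swap[of x R y] assms by simp

lemma psd_swap: "psd R \<Longrightarrow> x \<bullet> (R *v y) = y \<bullet> (R *v x)"
  by (metis inner_commute psd_transpose symmetric_swap)

lemma psd_quadratic_expand:
  assumes "psd R"
  shows "(x - t *\<^sub>R y) \<bullet> (R *v (x - t *\<^sub>R y))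
    = x \<bullet> (R *v x) - 2 * t * (y \<bullet> (R *v x)) + t\<^sup>2 * (y \<bullet> (R *v y))"
  using psd_swap[OF assms, of x y]
  by (simp add: matrix_vector_mult_diff_distrib matrix_vector_mult_scaleR inner_diff_left
      inner_diff_right power2_eq_square algebra_simps)

text \<open>The form at \<open>x - t *\<^sub>R y\<close> is a quadratic polynomial in
  \<open>t\<close> that never becomes negative.\<close>

lemma psd_Cauchy_Schwarz:
  assumes "psd R"
  shows "(x \<bullet> (R *v y))\<^sup>2 \<le> (x \<bullet> (R *v x)) * (y \<bullet> (R *v y))"
proof -
  let ?a = "x \<bullet> (R *v x)" and ?b = "y \<bullet> (R *v x)" and ?c = "y \<bullet> (R *v y)"
  have ge: "0 \<le> ?a - 2 * t * ?b + t\<^sup>2 * ?c" for t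
    using psd_nonneg[OF assms] psd_quadratic_expand[OF assms] by metis
  have "?b\<^sup>2 \<le> ?a * ?c"
  proof (cases "?c = 0")
    case True
    have "?b = 0"
    proof (rule ccontr)
      assume "?b \<noteq> 0"
      \<comment> \<open>With \<open>?c = 0\<close> the polynomial is affine in \<open>t\<close>, and
        this \<open>t\<close> gives it the value -1.\<close>
      then show False using ge[of "(?a + 1) / (2 * ?b)"] True by (simp add: field_simps)
    qed
    then show ?thesis using True by simp
  next
    case False
    then have "?c > 0" using psd_nonneg[OF assms, of y] by simp
    \<comment> \<open>Here \<open>t\<close> is the minimiser of the quadratic.\<close>
    then show ?thesis using ge[of "?b / ?c"] by (simp add: field_simps power2_eq_square)
  qed
  then show ?thesis using psd_swap[OF assms, of x y] by simp
qed

lemma psd_null_vector: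
  assumes "psd R" "x \<bullet> (R *v x) = 0"
  shows "R *v x = 0"
  using psd_Cauchy_Schwarz[OF assms(1), of "R *v x" x] assms(2) by simp

lemma psd_pos:
  assumes "psd R" "R *v x \<noteq> 0"
  shows "0 < x \<bullet> (R *v x)"
  using psd_null_vector[OF assms(1), of x] psd_nonneg[OF assms(1), of x] assms(2) by force

lemma trace_eq_sum_axis: "trace R = (\<Sum>i\<in>UNIV. axis i 1 \<bullet> (R *v axis i (1::real)))"
  by (simp add: trace_def inner_axis' matrix_vector_mult_basis column_def)

lemma psd_trace_nonneg: "psd R \<Longrightarrow> 0 \<le> trace R"
  unfolding trace_eq_sum_axis by (intro sum_nonneg psd_nonneg)

section \<open>Rank-one deflation of a positive semidefinite matrix\<close>

definition deflate :: "real^'n^'n \<Rightarrow> real^'n \<Rightarrow> real^'n^'n" where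
  "deflate R u = R - outer (R *v u) (R *v u) /\<^sub>R (u \<bullet> (R *v u))"

lemma deflate_mult_vec:
  "deflate R u *v v = R *v v - (((R *v u) \<bullet> v) / (u \<bullet> (R *v u))) *\<^sub>R (R *v u)"
  by (simp add: deflate_def matrix_vector_mult_diff_rdistrib scaleR_matrix_vector_assoc[symmetric]
      divide_inverse mult.commute)

lemma deflate_trivial: "R *v u = 0 \<Longrightarrow> deflate R u = R"
  by (simp add: deflate_def outer_def vec_eq_iff)

text \<open>Cauchy-Schwarz bounds the subtracted square by \<open>v \<bullet> (R *v v)\<close>. If
  the denominator vanishes, division by zero yields 0 and nothing is subtracted.\<close>

lemma psd_deflate:
  assumes R: "psd R"
  shows "psd (deflate R u)"
  unfolding psd_def
proof safe
  show "transpose (deflate R u) = deflate R u"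
    by (simp add: deflate_def transpose_diff transpose_scaleR psd_transpose[OF R])
  fix v
  have "v \<bullet> (deflate R u *v v) = v \<bullet> (R *v v) - (v \<bullet> (R *v u))\<^sup>2 / (u \<bullet> (R *v u))"
    by (simp add: deflate_mult_vec inner_diff_right power2_eq_square inner_commute)
  moreover have "(v \<bullet> (R *v u))\<^sup>2 / (u \<bullet> (R *v u)) \<le> v \<bullet> (R *v v)"
    using psd_Cauchy_Schwarz[OF R, of v u] psd_nonneg[OF R]
    by (cases "u \<bullet> (R *v u) = 0") (auto simp: divide_le_eq less_le)
  ultimately show "0 \<le> v \<bullet> (deflate R u *v v)" by simp
qed

lemma deflate_direction:
  assumes "psd R"
  shows "deflate R u *v u = 0"
  using psd_pos[OF assms, of u]
  by (cases "R *v u = 0") (auto simp: deflate_mult_vec inner_commute)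

lemma deflate_kernel:
  assumes "psd R" "R *v v = 0"
  shows "deflate R u *v v = 0"
  using assms psd_swap[of R u v] by (simp add: deflate_mult_vec inner_commute)

lemma trace_deflate:
  "trace (deflate R u) = trace R - (norm (R *v u))\<^sup>2 / (u \<bullet> (R *v u))"
  by (simp add: deflate_def trace_sub trace_scaleR dot_square_norm divide_inverse mult.commute)

lemma trace_deflate_le: "psd R \<Longrightarrow> trace (deflate R u) \<le> trace R"
  using psd_nonneg[of R u] by (simp add: trace_deflate)

text \<open>The deflated matrix is symmetric and annihilates \<open>u\<close>, so its range is
  orthogonal to \<open>u\<close>. The vector \<open>R *v u\<close> is not, hence the inclusion of
  the ranges is strict.\<close>

lemma dim_range_deflate:
  assumes R: "psd R" and u: "R *v u \<noteq> 0"
  shows "dim (range ((*v) (deflate R u))) < dim (range ((*v) R))"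
proof (rule dim_psubset)
  have sub: "range ((*v) (deflate R u)) \<subseteq> range ((*v) R)"
  proof clarify
    fix v
    have "deflate R u *v v = R *v (v - (((R *v u) \<bullet> v) / (u \<bullet> (R *v u))) *\<^sub>R u)"
      by (simp add: deflate_mult_vec matrix_vector_mult_diff_distrib matrix_vector_mult_scaleR)
    then show "deflate R u *v v \<in> range ((*v) R)" by blast
  qed
  have "R *v u \<notin> range ((*v) (deflate R u))"
  proof
    assume "R *v u \<in> range ((*v) (deflate R u))"
    then obtain v where "R *v u = deflate R u *v v" by blast
    then have "u \<bullet> (R *v u) = v \<bullet> (deflate R u *v u)"
      by (simp add: psd_swap[OF psd_deflate[OF R]])
    then show False using psd_pos[OF R u] by (simp add: deflate_direction[OF R])
  qed
  then have "range ((*v) (deflate R u)) \<subset> range ((*v) R)" using sub by blast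
  moreover have "span (range ((*v) X)) = range ((*v) X)" for X :: "real^'n^'n"
    by (intro span_eq_iff[THEN iffD2] linear_subspace_image matrix_vector_mul_linear subspace_UNIV)
  ultimately show "span (range ((*v) (deflate R u))) \<subset> span (range ((*v) R))"
    by metis
qed

lemma dim_range_zero: "dim (range ((*v) (0 :: real^'n^'n))) = 0"
  by (simp add: image_def)

text \<open>Induction on the rank of \<open>X\<close>, in place of a spectral decomposition: each
  deflation splits off a multiple of \<open>outer y y\<close> with \<open>y = X *v u\<close>, whose
  trace against \<open>R\<close> is a nonnegative multiple of
  \<open>y \<bullet> (R *v y)\<close>.\<close>

lemma trace_mul_psd_nonneg:
  fixes X R :: "real^'n^'n"
  assumes "psd X" and R: "psd R"
  shows "0 \<le> trace (R ** X)"
  using assms(1)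
proof (induction "dim (range ((*v) X))" arbitrary: X rule: less_induct)
  case less
  show ?case
  proof (cases "X = 0")
    case True
    then show ?thesis by (simp add: trace_def matrix_matrix_mult_def)
  next
    case False
    then obtain u where u: "X *v u \<noteq> 0"
      by (metis matrix_eq matrix_vector_mult_0)
    have "0 \<le> trace (R ** deflate X u)"
      using less.hyps[OF dim_range_deflate[OF less.prems u] psd_deflate[OF less.prems]] .
    moreover have "trace (R ** deflate X u)
      = trace (R ** X) - ((X *v u) \<bullet> (R *v (X *v u))) / (u \<bullet> (X *v u))"
      by (simp add: deflate_def matrix_mul_diff_ldistrib trace_sub matrix_mul_scaleR trace_scaleR
          matrix_mul_outer inner_commute divide_inverse mult.commute)
    ultimately show ?thesis
      using psd_nonneg[OF R, of "X *v u"] psd_nonneg[OF less.prems, of u]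
      by (smt (verit) divide_nonneg_nonneg)
  qed
qed

section \<open>Positive definite matrices and their inverses\<close>

definition posdef :: "real^'n^'n \<Rightarrow> bool" where
  "posdef A \<longleftrightarrow> transpose A = A \<and> (\<forall>v. v \<noteq> 0 \<longrightarrow> 0 < v \<bullet> (A *v v))"

lemma posdef_psd:
  assumes "posdef A"
  shows "psd A"
proof -
  have "0 \<le> v \<bullet> (A *v v)" for v
    using assms by (cases "v = 0") (auto simp: posdef_def less_imp_le)
  then show ?thesis using assms by (simp add: psd_def posdef_def)
qed

lemma posdef_mat_1: "posdef (mat 1)"
  by (simp add: posdef_def transpose_mat)

lemma posdef_pos: "posdef A \<Longrightarrow> v \<noteq> 0 \<Longrightarrow> 0 < v \<bullet> (A *v v)"
  by (simp add: posdef_def)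

lemma posdef_mult_eq_0_iff: "posdef A \<Longrightarrow> A *v v = 0 \<longleftrightarrow> v = 0"
  using posdef_pos[of A v] by (cases "v = 0") auto

text \<open>\<open>matrix_inv\<close> is defined by choice. For square matrices a one-sided inverse
  is two-sided and determines what is chosen.\<close>

lemma matrix_inv_unique:
  fixes A B :: "real^'n^'n"
  assumes "A ** B = mat 1"
  shows "matrix_inv B = A"
proof -
  have "B ** A = mat 1" using assms by (simp add: matrix_left_right_inverse)
  then have "invertible B" using assms by (auto simp: invertible_def)
  then have "B ** matrix_inv B = mat 1"
    unfolding matrix_inv_def invertible_def by (rule someI2_ex) simp
  then have "A ** B ** matrix_inv B = A" by (simp flip: matrix_mul_assoc)
  then show ?thesis using assms by simp
qed

lemma posdef_inverse:
  assumes "posdef A"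
  shows "A ** matrix_inv A = mat 1" "matrix_inv A ** A = mat 1"
    "A *v (matrix_inv A *v v) = v" "matrix_inv A *v (A *v v) = v"
proof -
  have "inj ((*v) A)"
  proof (rule injI)
    fix x y assume "A *v x = A *v y"
    then have "A *v (x - y) = 0" by (simp add: matrix_vector_mult_diff_distrib)
    then show "x = y" using posdef_mult_eq_0_iff[OF assms] by simp
  qed
  then obtain B where B: "B ** A = mat 1"
    using matrix_left_invertible_injective by blast
  show "A ** matrix_inv A = mat 1" "matrix_inv A ** A = mat 1"
    using B matrix_inv_unique[OF B] matrix_left_right_inverse by auto
  then show "A *v (matrix_inv A *v v) = v" "matrix_inv A *v (A *v v) = v"
    by (simp_all add: matrix_vector_mul_assoc)
qed

lemma psd_matrix_inv:
  assumes A: "posdef A"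
  shows "psd (matrix_inv A)"
  unfolding psd_def
proof safe
  have "transpose (matrix_inv A) ** A = mat 1"
    using arg_cong[OF posdef_inverse(1)[OF A], of transpose] A
    by (simp add: matrix_transpose_mul transpose_mat posdef_def)
  then show "transpose (matrix_inv A) = matrix_inv A"
    by (rule matrix_inv_unique[symmetric])
  fix v
  show "0 \<le> v \<bullet> (matrix_inv A *v v)"
    using psd_nonneg[OF posdef_psd[OF A], of "matrix_inv A *v v"]
    by (simp add: posdef_inverse(3)[OF A] inner_commute)
qed

lemma posdef_add_psd:
  fixes A G :: "real^'n^'n"
  assumes A: "posdef A" and R: "psd (G - A)"
  shows "posdef G"
  unfolding posdef_def
proof safe
  show "transpose G = G"
    using A psd_transpose[OF R] by (simp add: posdef_def transpose_diff)
  fix v :: "real^'n" assume "v \<noteq> 0"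
  then show "0 < v \<bullet> (G *v v)"
    using posdef_pos[OF A, of v] psd_nonneg[OF R, of v]
    by (simp add: matrix_vector_mult_diff_rdistrib inner_diff_right)
qed

lemma posdef_of_loewner:
  fixes A :: "real^'n^'n"
  assumes "transpose A = A" "0 < \<mu>" "mat \<mu> \<preceq> A"
  shows "posdef A" "\<mu> * (v \<bullet> v) \<le> v \<bullet> (A *v v)"
proof -
  have "(mat \<mu> :: real^'n^'n) *v v = \<mu> *\<^sub>R v" for v :: "real^'n"
    by (simp add: mat_def matrix_vector_mult_def vec_eq_iff if_distrib if_distribR
        sum.delta cong: if_cong)
  then show ge: "\<mu> * (v \<bullet> v) \<le> v \<bullet> (A *v v)" for v
    using psd_nonneg[OF assms(3)[unfolded loewner_le_def], of v]
    by (simp add: matrix_vector_mult_diff_rdistrib inner_diff_right)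
  have "0 < v \<bullet> (A *v v)" if "v \<noteq> 0" for v
    by (rule less_le_trans[OF _ ge]) (use that assms(2) in simp)
  then show "posdef A"
    using assms(1) by (simp add: posdef_def)
qed

text \<open>Loewner monotonicity of the trace pairing, applied to
  \<open>v v\<^sup>T / (v\<^sup>T A v) \<preceq> A\<^sup>-\<^sup>1\<close>, which is the Cauchy--Schwarz inequality.\<close>

lemma quadratic_form_le_trace:
  assumes A: "posdef A" and R: "psd R"
  shows "v \<bullet> (R *v v) \<le> trace (R ** matrix_inv A) * (v \<bullet> (A *v v))"
proof (cases "v = 0")
  case False
  let ?a = "v \<bullet> (A *v v)"
  have a: "0 < ?a" by (rule posdef_pos[OF A False])
  define X where "X = matrix_inv A - outer v v /\<^sub>R ?a"
  have "psd X"
    unfolding psd_def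
  proof safe
    show "transpose X = X"
      by (simp add: X_def transpose_diff transpose_scaleR psd_transpose[OF psd_matrix_inv[OF A]])
    fix y
    let ?z = "matrix_inv A *v y"
    have "(v \<bullet> y)\<^sup>2 \<le> ?a * (?z \<bullet> y)"
      using psd_Cauchy_Schwarz[OF posdef_psd[OF A], of v ?z] by (simp add: posdef_inverse(3)[OF A])
    then have "(v \<bullet> y)\<^sup>2 / ?a \<le> y \<bullet> ?z"
      using a by (simp add: divide_le_eq inner_commute[of y] mult.commute[of _ ?a])
    moreover have "X *v y = ?z - ((v \<bullet> y) / ?a) *\<^sub>R v"
      by (simp add: X_def matrix_vector_mult_diff_rdistrib scaleR_matrix_vector_assoc[symmetric]
          divide_inverse mult.commute)
    ultimately show "0 \<le> y \<bullet> (X *v y)"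
      by (simp add: inner_diff_right power2_eq_square inner_commute[of y v])
  qed
  from trace_mul_psd_nonneg[OF this R] have "(v \<bullet> (R *v v)) / ?a \<le> trace (R ** matrix_inv A)"
    by (simp add: X_def matrix_mul_diff_ldistrib trace_sub matrix_mul_scaleR trace_scaleR
        matrix_mul_outer inner_commute divide_inverse mult.commute)
  then show ?thesis using a by (simp add: divide_le_eq)
qed simp

section \<open>Newton decrement and matrix updates\<close>

lemma gradient_quadratic:
  assumes "transpose A = A"
  shows "gradient (quadratic A b) x = A *v x - b"
proof (rule gradient_eqI)
  have "((\<lambda>x. 1/2 * (x \<bullet> (A *v x)) - b \<bullet> x) has_derivative
     (\<lambda>h. 1/2 * (x \<bullet> (A *v h) + h \<bullet> (A *v x)) - b \<bullet> h)) (at x)"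
    by (intro has_derivative_diff has_derivative_mult_right has_derivative_inner
        has_derivative_ident has_derivative_inner_right
        bounded_linear_imp_has_derivative matrix_vector_mul_bounded_linear)
  moreover have "x \<bullet> (A *v h) = h \<bullet> (A *v x)" for h
    using symmetric_swap[OF assms, of x h] by (simp add: inner_commute)
  ultimately show "GDERIV (quadratic A b) x :> A *v x - b"
    by (simp add: gderiv_def quadratic_def[abs_def] inner_diff_right inner_commute)
qed

text \<open>With \<open>h\<close> the step and \<open>A *v p\<close> the new gradient, the squared
  decrements are the \<open>A\<close>-forms of \<open>p\<close> (new) and \<open>h + p\<close>
  (old). Both are compared with the \<open>A\<close>-form of \<open>h\<close>.\<close>

lemma newton_decrement_step:
  assumes A: "posdef A" and R: "psd (G - A)" and \<rho>: "0 \<le> \<rho>"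
    and le: "\<And>v. v \<bullet> ((G - A) *v v) \<le> \<rho> * (v \<bullet> (A *v v))"
    and x': "x' = x - matrix_inv G *v gradient (quadratic A b) x"
  shows "newton_decrement (quadratic A b) A x' \<le> \<rho> * newton_decrement (quadratic A b) A x"
proof -
  have G: "posdef G" by (rule posdef_add_psd[OF A R])
  have grad: "gradient (quadratic A b) y = A *v y - b" for y
    using A by (simp add: gradient_quadratic posdef_def)
  define g where "g = A *v x - b"
  define h where "h = matrix_inv G *v g"
  define p where "p = matrix_inv A *v ((G - A) *v h)"
  have Gh: "G *v h = g" by (simp add: h_def posdef_inverse[OF G])
  have Ap: "A *v p = (G - A) *v h" by (simp add: p_def posdef_inverse[OF A])
  have g': "A *v x' - b = (G - A) *v h"
    by (simp add: x' grad matrix_vector_mult_diff_distrib matrix_vector_mult_diff_rdistrib Gh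
        flip: g_def h_def)
  have g: "g = A *v (h + p)"
    by (simp add: matrix_vector_right_distrib Ap matrix_vector_mult_diff_rdistrib Gh)
  let ?s = "p \<bullet> (A *v p)" and ?t = "h \<bullet> (A *v h)" and ?q = "(h + p) \<bullet> (A *v (h + p))"
  \<comment> \<open>The cross term is \<open>h \<bullet> (A *v p)\<close>, which equals
    \<open>h \<bullet> ((G - A) *v h)\<close> and is therefore nonnegative.\<close>
  have q: "?t \<le> ?q"
    using psd_swap[OF posdef_psd[OF A], of p h] psd_nonneg[OF R, of h]
      psd_nonneg[OF posdef_psd[OF A], of p]
    by (simp add: matrix_vector_right_distrib inner_add_left inner_add_right Ap)
  have s0: "0 \<le> ?s" and t0: "0 \<le> ?t"
    using psd_nonneg[OF posdef_psd[OF A]] by auto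
  \<comment> \<open>Cauchy-Schwarz for \<open>G - A\<close>; the assumed bound then applies to both
    factors, which is where the square of \<rho> comes from.\<close>
  have "?s\<^sup>2 \<le> (p \<bullet> ((G - A) *v p)) * (h \<bullet> ((G - A) *v h))"
    unfolding Ap by (rule psd_Cauchy_Schwarz[OF R])
  also have "\<dots> \<le> (\<rho> * ?s) * (\<rho> * ?t)"
    using s0 \<rho> by (intro mult_mono le psd_nonneg[OF R]) auto
  finally have "?s * ?s \<le> ?s * (\<rho>\<^sup>2 * ?t)"
    by (simp add: power2_eq_square mult_ac)
  then have "?s \<le> \<rho>\<^sup>2 * ?t"
    using s0 t0 by (cases "?s = 0") (auto simp: mult_le_cancel_left)
  also have "\<dots> \<le> \<rho>\<^sup>2 * ?q" by (intro mult_left_mono q) simp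
  finally have "sqrt ?s \<le> sqrt (\<rho>\<^sup>2 * ?q)" by simp
  then have "sqrt ?s \<le> \<rho> * sqrt ?q" using \<rho> by (simp add: real_sqrt_mult)
  moreover have "newton_decrement (quadratic A b) A x = sqrt ?q"
    by (simp add: newton_decrement_def grad g posdef_inverse[OF A] inner_commute flip: g_def)
  moreover have "newton_decrement (quadratic A b) A x' = sqrt ?s"
    by (simp add: newton_decrement_def grad g' posdef_inverse[OF A] inner_commute flip: Ap)
  ultimately show ?thesis by simp
qed

text \<open>For symmetric \<open>G - A\<close> the second branch of \<open>SR1\<close> is literally
  a deflation. In the first branch \<open>u\<close> lies in the kernel of \<open>G - A\<close>,
  where deflation changes nothing.\<close>

lemma SR1_diff:
  assumes "psd (G - A)"
  shows "SR1 G A u - A = deflate (G - A) u"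
proof (cases "G *v u = A *v u")
  case True
  then have "(G - A) *v u = 0" by (simp add: matrix_vector_mult_diff_rdistrib)
  then show ?thesis using True by (simp add: SR1_def deflate_trivial)
next
  case False
  then show ?thesis
    using psd_transpose[OF assms]
    by (simp add: SR1_def deflate_def matrix_mul_outer outer_matrix_mul)
qed

section \<open>The BFGS update, its gap and its factor\<close>

definition bfgs_gap :: "real^'n^'n \<Rightarrow> real^'n^'n \<Rightarrow> real" where
  "bfgs_gap A G = trace (G ** matrix_inv A) - CARD('n)"

lemma bfgs_gap_eq:
  assumes "posdef A"
  shows "bfgs_gap A G = trace ((G - A) ** matrix_inv (A :: real^'n^'n))"
proof -
  have "(G - A) ** matrix_inv A = G ** matrix_inv A - A ** matrix_inv A"
    by (simp add: matrix_eq matrix_vector_mul_assoc[symmetric] matrix_vector_mult_diff_rdistrib)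
  then show ?thesis
    by (simp add: bfgs_gap_def trace_sub trace_I posdef_inverse[OF assms])
qed

lemma bfgs_gap_nonneg: "posdef A \<Longrightarrow> psd (G - A) \<Longrightarrow> 0 \<le> bfgs_gap A G"
  unfolding bfgs_gap_eq by (intro trace_mul_psd_nonneg psd_matrix_inv)

lemma BFGS_symmetric:
  assumes "transpose G = G" "transpose A = A"
  shows "BFGS G A u = G - outer (G *v u) (G *v u) /\<^sub>R (u \<bullet> (G *v u))
    + outer (A *v u) (A *v u) /\<^sub>R (u \<bullet> (A *v u))"
  using assms by (simp add: BFGS_def matrix_mul_outer outer_matrix_mul)

lemma BFGS_mult_vec:
  assumes "transpose G = G" "transpose A = A"
  shows "BFGS G A u *v x = G *v x - ((u \<bullet> (G *v x)) / (u \<bullet> (G *v u))) *\<^sub>R (G *v u)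
    + ((u \<bullet> (A *v x)) / (u \<bullet> (A *v u))) *\<^sub>R (A *v u)"
  by (simp add: BFGS_symmetric[OF assms] matrix_vector_mult_diff_rdistrib
      matrix_vector_mult_add_rdistrib scaleR_matrix_vector_assoc[symmetric] divide_inverse
      symmetric_swap[OF assms(1)] symmetric_swap[OF assms(2)] mult.commute)

text \<open>For positive semidefinite \<open>X\<close>, the number \<open>v\<^sup>T X v - (u\<^sup>T X v)\<^sup>2 / (u\<^sup>T X u)\<close> is the minimum
  of \<open>(v - t u)\<^sup>T X (v - t u)\<close> over \<open>t\<close>, hence monotone in \<open>X\<close>.\<close>

lemma psd_BFGS:
  assumes A: "posdef A" and R: "psd (G - A)"
  shows "psd (BFGS G A u - A)"
proof (cases "u = 0")
  case True
  then have "BFGS G A u = G" by (simp add: BFGS_def)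
  then show ?thesis using R by simp
next
  case False
  have G: "posdef G" by (rule posdef_add_psd[OF A R])
  have sG: "transpose G = G" and sA: "transpose A = A" using A G by (auto simp: posdef_def)
  let ?g = "u \<bullet> (G *v u)" and ?a = "u \<bullet> (A *v u)"
  have a: "0 < ?a" and g: "0 < ?g" using posdef_pos[OF A False] posdef_pos[OF G False] by auto
  show ?thesis
    unfolding psd_def
  proof safe
    show "transpose (BFGS G A u - A) = BFGS G A u - A"
      by (simp add: BFGS_symmetric[OF sG sA] transpose_diff transpose_add transpose_scaleR sG sA)
    fix v
    let ?b = "u \<bullet> (G *v v)" and ?c = "u \<bullet> (A *v v)"
    \<comment> \<open>The minimiser for \<open>G\<close> is inserted into both forms: it attains the
      minimum for \<open>G\<close> and only overestimates the one for \<open>A\<close>.\<close>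
    define t where "t = ?b / ?g"
    have "?c\<^sup>2 / ?a - 2 * t * ?c + t\<^sup>2 * ?a = (?c - t * ?a)\<^sup>2 / ?a"
      using a by (simp add: field_simps power2_eq_square)
    moreover have "0 \<le> (?c - t * ?a)\<^sup>2 / ?a" using a by simp
    ultimately have "v \<bullet> (A *v v) - ?c\<^sup>2 / ?a \<le> v \<bullet> (A *v v) - 2 * t * ?c + t\<^sup>2 * ?a"
      by linarith
    also have "\<dots> = (v - t *\<^sub>R u) \<bullet> (A *v (v - t *\<^sub>R u))"
      by (rule psd_quadratic_expand[OF posdef_psd[OF A], symmetric])
    also have "\<dots> \<le> (v - t *\<^sub>R u) \<bullet> (G *v (v - t *\<^sub>R u))"
      using psd_nonneg[OF R, of "v - t *\<^sub>R u"]
      by (simp add: matrix_vector_mult_diff_rdistrib inner_diff_right)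
    also have "\<dots> = v \<bullet> (G *v v) - 2 * t * ?b + t\<^sup>2 * ?g"
      by (rule psd_quadratic_expand[OF posdef_psd[OF G]])
    also have "\<dots> = v \<bullet> (G *v v) - ?b\<^sup>2 / ?g"
      using g by (simp add: t_def field_simps power2_eq_square)
    finally have "v \<bullet> (A *v v) - ?c\<^sup>2 / ?a \<le> v \<bullet> (G *v v) - ?b\<^sup>2 / ?g" .
    then show "0 \<le> v \<bullet> ((BFGS G A u - A) *v v)"
      using psd_swap[OF posdef_psd[OF A], of u v] psd_swap[OF posdef_psd[OF G], of u v]
      by (simp add: matrix_vector_mult_diff_rdistrib BFGS_mult_vec[OF sG sA] inner_diff_right
          inner_add_right power2_eq_square)
  qed
qed

definition bfgs_invariant :: "real^'n^'n \<Rightarrow> real^'n^'n \<Rightarrow> real^'n^'n \<Rightarrow> bool" where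
  "bfgs_invariant A G K \<longleftrightarrow> psd (G - A) \<and> transpose K ** K = matrix_inv G"

lemma bfgs_factor_inverse:
  fixes G K :: "real^'n^'n"
  assumes "posdef G" "transpose K ** K = matrix_inv G"
  shows "transpose K ** (K ** G) = mat 1" "K ** G ** transpose K = mat 1"
proof -
  show *: "transpose K ** (K ** G) = mat 1"
    by (simp add: matrix_mul_assoc assms posdef_inverse)
  then show "K ** G ** transpose K = mat 1"
    using matrix_left_right_inverse by blast
qed

lemma bfgs_direction_nonzero:
  fixes G K :: "real^'n^'n"
  assumes "posdef G" "transpose K ** K = matrix_inv G" "w \<noteq> 0"
  shows "transpose K *v w \<noteq> 0"
proof
  assume "transpose K *v w = 0"
  then have "(K ** G ** transpose K) *v w = 0"
    by (simp add: matrix_vector_mul_assoc[symmetric])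
  then show False using bfgs_factor_inverse(2)[OF assms(1,2)] assms(3) by simp
qed

text \<open>It is checked on vectors that \<open>transpose K' ** K'\<close> inverts the updated
  matrix. The image of \<open>x\<close> splits into \<open>G\<close> applied to the part of
  \<open>x\<close> that is \<open>G\<close>-orthogonal to \<open>u\<close>, and a multiple of
  \<open>A *v u\<close>; the new factor acts like \<open>K\<close> on the first and sends
  \<open>A *v u\<close> to \<open>v\<close>.\<close>

lemma bfgs_invariant_step:
  assumes A: "posdef A" and inv: "bfgs_invariant A G K" and u: "u = transpose K *v w"
  shows "bfgs_invariant A (BFGS G A u) (BFGS_factor K A u w)"
proof (cases "w = 0")
  case True
  \<comment> \<open>Both updates return their input at \<open>u = 0\<close>, because
    \<open>inverse 0 = 0\<close>.\<close>
  then have "u = 0" by (simp add: u)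
  then show ?thesis using inv by (simp add: BFGS_def BFGS_factor_def)
next
  case False
  have R: "psd (G - A)" and KK: "transpose K ** K = matrix_inv G"
    using inv by (auto simp: bfgs_invariant_def)
  have G: "posdef G" by (rule posdef_add_psd[OF A R])
  have sG: "transpose G = G" and sA: "transpose A = A" using A G by (auto simp: posdef_def)
  have u0: "u \<noteq> 0" unfolding u by (rule bfgs_direction_nonzero[OF G KK False])
  let ?g = "u \<bullet> (G *v u)" and ?a = "u \<bullet> (A *v u)"
  have a: "0 < ?a" and g: "0 < ?g" using posdef_pos[OF A u0] posdef_pos[OF G u0] by auto
  define v where "v = (sqrt ?a / norm w) *\<^sub>R w"
  define K' where "K' = BFGS_factor K A u w"
  have vv: "v \<bullet> v = ?a"
    using a False by (simp add: v_def dot_square_norm power2_eq_square field_simps)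
  have Kv: "transpose K *v v = (sqrt ?a / norm w) *\<^sub>R u"
    by (simp add: v_def u matrix_vector_mult_scaleR)
  have K': "K' *v y = K *v (y - ((u \<bullet> y) / ?a) *\<^sub>R (A *v u)) + ((u \<bullet> y) / ?a) *\<^sub>R v" for y
    by (simp add: K'_def BFGS_factor_def Let_def flip: v_def)
      (simp add: matrix_vector_mult_diff_rdistrib matrix_vector_mult_diff_distrib
        matrix_vector_mult_scaleR scaleR_matrix_vector_assoc[symmetric] divide_inverse algebra_simps)
  have K'T: "transpose K' *v z = transpose K *v z - (((A *v u) \<bullet> (transpose K *v z)) / ?a) *\<^sub>R u
      + ((v \<bullet> z) / ?a) *\<^sub>R u" for z
    by (simp add: K'_def BFGS_factor_def Let_def flip: v_def)
      (simp add: transpose_diff transpose_scaleR matrix_vector_mult_diff_rdistrib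
        scaleR_matrix_vector_assoc[symmetric] inner_matrix_vector_swap[of _ "transpose K"]
        divide_inverse algebra_simps)
  have "(transpose K' ** K' ** BFGS G A u) *v x = x" for x
  proof -
    let ?y = "BFGS G A u *v x" and ?c = "(u \<bullet> (A *v x)) / ?a" and ?b = "(u \<bullet> (G *v x)) / ?g"
    \<comment> \<open>This is the secant equation: the updated matrix agrees with \<open>A\<close>
      on \<open>u\<close>, here read through symmetry.\<close>
    have uy: "u \<bullet> ?y = u \<bullet> (A *v x)"
      using a g by (simp add: BFGS_mult_vec[OF sG sA] inner_add_right inner_diff_right)
    have "?y - ?c *\<^sub>R (A *v u) = G *v (x - ?b *\<^sub>R u)"
      by (simp add: BFGS_mult_vec[OF sG sA] matrix_vector_mult_diff_distrib matrix_vector_mult_scaleR)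
    then have K'y: "K' *v ?y = K *v (G *v (x - ?b *\<^sub>R u)) + ?c *\<^sub>R v"
      by (simp add: K' uy)
    have KKG: "transpose K *v (K *v (G *v z)) = z" for z
      using bfgs_factor_inverse(1)[OF G KK]
      by (simp add: matrix_vector_mul_assoc matrix_mul_assoc)
    have 1: "transpose K *v (K' *v ?y) = x - ?b *\<^sub>R u + (?c * (sqrt ?a / norm w)) *\<^sub>R u"
      by (simp add: K'y matrix_vector_right_distrib KKG Kv matrix_vector_mult_scaleR
         )
    \<comment> \<open>By this orthogonality the \<open>K\<close> part of \<open>K' *v ?y\<close> has
      no component along \<open>v\<close>.\<close>
    have "u \<bullet> (G *v (x - ?b *\<^sub>R u)) = 0"
      using g by (simp add: matrix_vector_mult_diff_distrib matrix_vector_mult_scaleR inner_diff_right)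
    moreover have "v \<bullet> (K *v z) = (sqrt ?a / norm w) * (u \<bullet> z)" for z
      by (simp add: inner_matrix_vector_swap[of v K] Kv)
    ultimately have 2: "v \<bullet> (K' *v ?y) = ?c * ?a"
      by (simp add: K'y inner_add_right vv)
    have 3: "(A *v u) \<bullet> (transpose K *v (K' *v ?y))
        = u \<bullet> (A *v x) - ?b * ?a + ?c * (sqrt ?a / norm w) * ?a"
      unfolding 1 by (simp add: symmetric_swap[OF sA, symmetric] inner_diff_right inner_add_right
          matrix_vector_mult_diff_distrib matrix_vector_right_distrib matrix_vector_mult_scaleR)
    have coeff: "(u \<bullet> (A *v x) - ?b * ?a + ?c * (sqrt ?a / norm w) * ?a) / ?a
        = ?c - ?b + ?c * (sqrt ?a / norm w)" "(?c * ?a) / ?a = ?c"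
      using a by (auto simp: field_simps)
    show ?thesis
      unfolding matrix_vector_mul_assoc[symmetric] K'T 3 2 coeff
      unfolding 1 by (simp add: algebra_simps)
  qed
  then have "transpose K' ** K' ** BFGS G A u = mat 1"
    by (simp add: matrix_eq)
  then have "transpose K' ** K' = matrix_inv (BFGS G A u)"
    by (rule matrix_inv_unique[symmetric])
  then show ?thesis
    using psd_BFGS[OF A R] by (simp add: bfgs_invariant_def K'_def)
qed

text \<open>Since \<open>K G\<close> is the transpose of \<open>K\<^sup>-\<^sup>1\<close>, this is the matrix whose quadratic form is maximised
  by the greedy BFGS direction; written this way, it depends polynomially on \<open>G\<close> and \<open>K\<close>.\<close>

definition bfgs_form :: "real^'n^'n \<Rightarrow> real^'n^'n \<Rightarrow> real^'n^'n \<Rightarrow> real^'n^'n" where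
  "bfgs_form A G K = K ** G ** matrix_inv A ** (G ** transpose K)"

text \<open>With \<open>?B = G ** transpose K\<close>, which is the inverse of \<open>K\<close>, the
  form is a congruence of the inverse of \<open>A\<close>, and its trace follows by cyclicity. In
  the update the added term has trace 1 against that inverse, while the removed one is the Rayleigh
  quotient of \<open>w\<close>, since \<open>u \<bullet> (G *v u) = w \<bullet> w\<close>.\<close>

lemma
  assumes A: "posdef A" and inv: "bfgs_invariant A G K"
  shows psd_bfgs_form: "psd (bfgs_form A G K)"
    and trace_bfgs_form: "trace (bfgs_form A G K) = trace (G ** matrix_inv A)"
    and bfgs_form_eq: "transpose (matrix_inv K) ** matrix_inv A ** matrix_inv K = bfgs_form A G K"
    and bfgs_gap_update: "w \<noteq> 0 \<Longrightarrow>
      bfgs_gap A (BFGS G A (transpose K *v w))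
        = bfgs_gap A G + 1 - (w \<bullet> (bfgs_form A G K *v w)) / (w \<bullet> w)"
proof -
  have R: "psd (G - A)" and KK: "transpose K ** K = matrix_inv G"
    using inv by (auto simp: bfgs_invariant_def)
  have G: "posdef G" by (rule posdef_add_psd[OF A R])
  have sG: "transpose G = G" and sA: "transpose A = A" using A G by (auto simp: posdef_def)
  let ?B = "G ** transpose K"
  have BT: "transpose ?B = K ** G" by (simp add: matrix_transpose_mul sG)
  have form: "bfgs_form A G K = transpose ?B ** matrix_inv A ** ?B"
    by (simp add: bfgs_form_def BT)
  have quad: "x \<bullet> (bfgs_form A G K *v x) = (?B *v x) \<bullet> (matrix_inv A *v (?B *v x))" for x
    unfolding form using inner_matrix_vector_swap[of x "transpose ?B"]
    by (simp add: matrix_vector_mul_assoc[symmetric] del: matrix_transpose_mul)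
  show "psd (bfgs_form A G K)"
    unfolding psd_def quad
    by (simp add: form matrix_transpose_mul psd_transpose[OF psd_matrix_inv[OF A]] matrix_mul_assoc
        psd_nonneg[OF psd_matrix_inv[OF A]])
  have "trace (bfgs_form A G K) = trace (?B ** (K ** G ** matrix_inv A))"
    unfolding form BT by (rule trace_mul_sym)
  also have "?B ** (K ** G ** matrix_inv A) = G ** (transpose K ** (K ** G)) ** matrix_inv A"
    by (simp only: matrix_mul_assoc)
  finally show "trace (bfgs_form A G K) = trace (G ** matrix_inv A)"
    by (simp add: bfgs_factor_inverse(1)[OF G KK])
  have "K ** ?B = mat 1" using bfgs_factor_inverse(2)[OF G KK] by (simp add: matrix_mul_assoc)
  then have "?B ** K = mat 1" using matrix_left_right_inverse by blast
  then have "matrix_inv K = ?B" by (rule matrix_inv_unique)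
  then show "transpose (matrix_inv K) ** matrix_inv A ** matrix_inv K = bfgs_form A G K"
    by (simp add: form)
  assume w: "w \<noteq> 0"
  define u where "u = transpose K *v w"
  have u0: "u \<noteq> 0" unfolding u_def by (rule bfgs_direction_nonzero[OF G KK w])
  have a: "0 < u \<bullet> (A *v u)" by (rule posdef_pos[OF A u0])
  have Gu: "G *v u = ?B *v w" by (simp add: u_def matrix_vector_mul_assoc)
  have "u \<bullet> (G *v u) = w \<bullet> (K *v (G *v u))"
    unfolding u_def by (simp add: inner_matrix_vector_swap[of w K])
  also have "K *v (G *v u) = w"
    using bfgs_factor_inverse(2)[OF G KK]
    by (simp add: u_def matrix_vector_mul_assoc matrix_mul_assoc)
  finally have uGu: "u \<bullet> (G *v u) = w \<bullet> w" .
  have "trace (BFGS G A u ** matrix_inv A) = trace (matrix_inv A ** BFGS G A u)"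
    by (rule trace_mul_sym)
  also have "\<dots> = trace (matrix_inv A ** G)
      - (matrix_inv A *v (G *v u)) \<bullet> (G *v u) / (u \<bullet> (G *v u)) + 1"
    using a by (simp add: BFGS_symmetric[OF sG sA] matrix_add_ldistrib matrix_mul_diff_ldistrib
        trace_add trace_sub matrix_mul_scaleR trace_scaleR matrix_mul_outer divide_inverse
        mult.commute posdef_inverse[OF A])
  finally show "bfgs_gap A (BFGS G A (transpose K *v w))
        = bfgs_gap A G + 1 - (w \<bullet> (bfgs_form A G K *v w)) / (w \<bullet> w)"
    unfolding u_def[symmetric]
    unfolding quad Gu[symmetric]
    by (simp only: bfgs_gap_def uGu trace_mul_sym[of "matrix_inv A" G] inner_commute)
qed

section \<open>Uniform distribution on the sphere\<close>

text \<open>The orthogonal invariance of the sphere measure is available for well-ordered index types only;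
  it is transported to an arbitrary finite index type along this well-ordered copy.\<close>

typedef 'a ranked = "UNIV :: 'a set" morphisms unranked ranked ..

lemma inj_unranked: "inj unranked" and surj_unranked: "range unranked = UNIV"
  by (auto simp: inj_on_def unranked_inject surj_def) (metis ranked_inverse UNIV_I)

instance ranked :: (finite) finite
  by standard (rule finite_imageD[OF _ inj_unranked], simp)

instantiation ranked :: (finite) wellorder
begin

definition "x \<le> y \<longleftrightarrow> to_nat_on UNIV (unranked x) \<le> to_nat_on UNIV (unranked y)"

definition "x < y \<longleftrightarrow> to_nat_on UNIV (unranked x) < to_nat_on UNIV (unranked y)"

instance
proof
  fix x y :: "'a ranked"
  assume "x \<le> y" "y \<le> x"
  then have "to_nat_on UNIV (unranked x) = to_nat_on UNIV (unranked y)"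
    by (simp add: less_eq_ranked_def)
  then show "x = y"
    using inj_on_to_nat_on[of "UNIV :: 'a set"] by (simp add: inj_on_eq_iff unranked_inject)
next
  fix P :: "'a ranked \<Rightarrow> bool" and a :: "'a ranked"
  assume "\<And>x. (\<And>y. y < x \<Longrightarrow> P y) \<Longrightarrow> P x"
  then show "P a"
    unfolding less_ranked_def
    by (induction a rule: measure_induct[of "\<lambda>x. to_nat_on UNIV (unranked x)"]) blast
qed (auto simp: less_eq_ranked_def less_ranked_def)

end

definition unrank_vec :: "real^'n ranked \<Rightarrow> real^'n" where
  "unrank_vec x = (\<chi> i. x $ ranked i)"

definition rank_vec :: "real^'n \<Rightarrow> real^'n ranked" where
  "rank_vec x = (\<chi> j. x $ unranked j)"

lemma unrank_rank_vec [simp]: "unrank_vec (rank_vec x) = x"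
  and rank_unrank_vec [simp]: "rank_vec (unrank_vec y) = y"
  by (simp_all add: unrank_vec_def rank_vec_def vec_eq_iff ranked_inverse unranked_inverse)

lemma linear_unrank_vec: "linear unrank_vec" and linear_rank_vec: "linear rank_vec"
  by (auto intro!: linearI simp: unrank_vec_def rank_vec_def vec_eq_iff)

lemma sum_unranked: "(\<Sum>j\<in>UNIV. f (unranked (j :: 'n::finite ranked))) = (\<Sum>i\<in>UNIV. f i)"
  using sum.reindex[OF inj_unranked, of f] by (simp add: surj_unranked comp_def)

lemma norm_rank_vec [simp]: "norm (rank_vec x) = norm x"
  using sum_unranked[of "\<lambda>i. x $ i * x $ i"]
  by (simp add: norm_eq_sqrt_inner inner_vec_def rank_vec_def)

lemma norm_unrank_vec [simp]: "norm (unrank_vec x) = norm x"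
  by (metis norm_rank_vec rank_unrank_vec)

lemma prod_Basis_vec:
  "(\<Prod>b\<in>(Basis :: (real^'n) set). f b) = (\<Prod>i\<in>UNIV. f (axis i 1))"
proof -
  have Basis: "Basis = range (\<lambda>i. axis i 1 :: real^'n)"
    by (auto simp: Basis_vec_def)
  have "inj (\<lambda>i. axis i 1 :: real^'n)"
    by (auto simp: inj_on_def axis_eq_axis)
  from prod.reindex[OF this, of f] show ?thesis
    unfolding Basis by (simp add: comp_def)
qed

lemma borel_measurable_linear:
  fixes T :: "'a::euclidean_space \<Rightarrow> 'b::euclidean_space"
  shows "linear T \<Longrightarrow> T \<in> borel_measurable borel"
  by (intro borel_measurable_continuous_onI linear_continuous_on)
    (simp add: linear_conv_bounded_linear)

text \<open>Relabelling coordinates maps boxes to boxes with the same side lengths, and Lebesgue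
  measure is determined by its values on boxes.\<close>

lemma distr_lborel_unrank_vec: "distr lborel borel unrank_vec = (lborel :: (real^'n) measure)"
proof (rule lborel_eqI[symmetric])
  note borel_measurable_linear[OF linear_unrank_vec, measurable]
  fix l u :: "real^'n"
  assume le: "\<And>b. b \<in> Basis \<Longrightarrow> l \<bullet> b \<le> u \<bullet> b"
  have le': "l $ i \<le> u $ i" for i
    using le[of "axis i 1"] by (auto simp: Basis_vec_def inner_axis)
  have "unrank_vec -` box l u = box (rank_vec l) (rank_vec u)"
    unfolding set_eq_iff vimage_eq mem_box_cart
    by (simp add: unrank_vec_def rank_vec_def) (metis ranked_inverse unranked_inverse UNIV_I)
  then have "emeasure (distr lborel borel unrank_vec) (box l u)
      = emeasure lborel (box (rank_vec l) (rank_vec u))"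
    by (simp add: emeasure_distr)
  also have "\<dots> = (\<Prod>b\<in>Basis. (rank_vec u - rank_vec l) \<bullet> b)"
    by (intro emeasure_lborel_box) (auto simp: Basis_vec_def inner_axis rank_vec_def le')
  also have "(\<Prod>b\<in>Basis. (rank_vec u - rank_vec l) \<bullet> b) = (\<Prod>b\<in>Basis. (u - l) \<bullet> b)"
    unfolding prod_Basis_vec
    using prod.reindex[OF inj_unranked, of "\<lambda>i. u $ i - l $ i"]
    by (simp add: inner_axis rank_vec_def surj_unranked comp_def)
  finally show "emeasure (distr lborel borel unrank_vec) (box l u) = (\<Prod>b\<in>Basis. (u - l) \<bullet> b)" .
qed simp

text \<open>A norm-preserving linear map preserves the unit ball and commutes with radial
  projection, so invariance passes from Lebesgue measure to the sphere.\<close>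

lemma distr_unif_sphere_isometry:
  fixes T :: "'a::euclidean_space \<Rightarrow> 'b::euclidean_space"
  assumes T: "linear T" "\<And>x. norm (T x) = norm x" and lborel: "distr lborel borel T = lborel"
  shows "distr unif_sphere borel T = unif_sphere"
proof (rule measure_eqI)
  note borel_measurable_linear[OF T(1), measurable]
  fix B assume "B \<in> sets (distr unif_sphere borel T)"
  then have [measurable]: "B \<in> sets borel" by simp
  have emb: "emeasure lborel (S :: 'b set) = emeasure lborel (T -` S)" if "S \<in> sets borel" for S
    using that by (subst lborel[symmetric]) (simp add: emeasure_distr)
  have "(\<lambda>x. x /\<^sub>R norm x) -` B \<in> sets borel"
    using measurable_sets[of "\<lambda>x::'b. x /\<^sub>R norm x" borel borel B] by simp
  moreover have "T -` ball 0 1 = ball 0 1" by (auto simp: T(2))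
  moreover have "T -` (\<lambda>x. x /\<^sub>R norm x) -` B = (\<lambda>x. T (x /\<^sub>R norm x)) -` B"
    by (simp add: vimage_def T(2) linear_scale[OF T(1)])
  moreover have "(\<lambda>x. T (x /\<^sub>R norm x)) -` B \<in> sets borel"
    using measurable_sets[of "\<lambda>x. T (x /\<^sub>R norm x)" borel borel B] by simp
  ultimately show "emeasure (distr unif_sphere borel T) B = emeasure unif_sphere B"
    unfolding unif_sphere_def
    by (simp add: emeasure_distr distr_distr comp_def emb[of "ball 0 1"]
        emb[of "ball 0 1 \<inter> (\<lambda>x. x /\<^sub>R norm x) -` B"])
qed simp

lemma distr_unif_sphere_orthogonal_transformation:
  fixes T :: "real^'n \<Rightarrow> real^'n"
  assumes T: "orthogonal_transformation T"
  shows "distr unif_sphere borel T = unif_sphere"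
proof -
  let ?T' = "\<lambda>x. rank_vec (T (unrank_vec x))"
  have linT: "linear T" using T by (rule orthogonal_transformation_linear)
  have T': "orthogonal_transformation ?T'"
    using T linear_compose[OF linear_compose[OF linear_unrank_vec linT] linear_rank_vec]
    by (simp add: orthogonal_transformation comp_def)
  note [measurable] = borel_measurable_linear[OF linear_unrank_vec]
    borel_measurable_linear[OF linT] borel_measurable_linear[OF orthogonal_transformation_linear[OF T']]
  have push: "distr unif_sphere borel unrank_vec = (unif_sphere :: (real^'n) measure)"
    by (rule distr_unif_sphere_isometry[OF linear_unrank_vec norm_unrank_vec
          distr_lborel_unrank_vec])
  have "distr unif_sphere borel T = distr unif_sphere borel (\<lambda>x. T (unrank_vec x))"
    by (subst push[symmetric]) (simp add: distr_distr comp_def)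
  also have "\<dots> = distr (distr unif_sphere borel ?T') borel unrank_vec"
    by (simp add: distr_distr comp_def)
  also have "\<dots> = unif_sphere"
    by (simp add: distr_unif_sphere_orthogonal[OF T'] push)
  finally show ?thesis .
qed

lemma integral_unif_sphere_orthogonal:
  fixes T :: "real^'n \<Rightarrow> real^'n" and f :: "real^'n \<Rightarrow> real"
  assumes T: "orthogonal_transformation T" and f: "f \<in> borel_measurable borel"
  shows "(\<integral>u. f (T u) \<partial>unif_sphere) = (\<integral>u. f u \<partial>unif_sphere)"
proof -
  have "T \<in> borel_measurable borel"
    using T by (intro borel_measurable_linear orthogonal_transformation_linear)
  then have "(\<integral>u. f u \<partial>distr unif_sphere borel T) = (\<integral>u. f (T u) \<partial>unif_sphere)"
    using f by (subst integral_distr) (simp_all add: measurable_def[of unif_sphere] measurable_def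
        measurable_cong_sets)
  then show ?thesis by (simp add: distr_unif_sphere_orthogonal_transformation[OF T])
qed

text \<open>A hyperplane through the origin is a Lebesgue null set, and radial projection neither
  enters nor leaves it away from the origin.\<close>

lemma AE_unif_sphere_inner_nonzero:
  assumes "c \<noteq> 0"
  shows "AE u in (unif_sphere :: 'a::euclidean_space measure). c \<bullet> u \<noteq> 0"
proof -
  have "{x. c \<bullet> x = 0} \<in> null_sets lborel"
    using negligible_hyperplane[of c 0] assms
    by (simp add: negligible_iff_null_sets null_sets_completion_iff)
  then have "AE x in lborel. c \<bullet> x \<noteq> 0"
    by (rule AE_I') auto
  moreover have "AE x in lborel. x \<noteq> (0::'a)"
    by (rule AE_lborel_singleton)
  ultimately have "AE x in uniform_measure lborel (ball 0 1). c \<bullet> (x /\<^sub>R norm x) \<noteq> 0"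
    by (intro AE_uniform_measureI) auto
  then show ?thesis
    unfolding unif_sphere_def by (subst AE_distr_iff) auto
qed

lemma AE_unif_sphere_mult_vec_nonzero:
  fixes R :: "real^'n^'m"
  assumes "R \<noteq> 0"
  shows "AE u in unif_sphere. R *v u \<noteq> 0"
proof -
  obtain i where "R $ i \<noteq> 0" using assms by (auto simp: vec_eq_iff)
  then have "AE u in unif_sphere. R $ i \<bullet> u \<noteq> 0"
    by (rule AE_unif_sphere_inner_nonzero)
  then show ?thesis
    by eventually_elim (metis matrix_vector_mul_component zero_index)
qed

text \<open>For \<open>e = 0\<close> this is the identity, so the map is orthogonal for every
  \<open>e\<close>.\<close>

definition reflection :: "'a::real_inner \<Rightarrow> 'a \<Rightarrow> 'a" where
  "reflection e u = u - (2 * (u \<bullet> e) / (e \<bullet> e)) *\<^sub>R e"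

lemma orthogonal_transformation_reflection: "orthogonal_transformation (reflection e)"
  unfolding orthogonal_transformation_def
proof safe
  show "linear (reflection e)"
    by (rule linearI)
      (simp_all add: reflection_def inner_add_left algebra_simps add_divide_distrib)
  fix v w
  show "reflection e v \<bullet> reflection e w = v \<bullet> w"
    by (cases "e = 0")
      (simp_all add: reflection_def inner_diff_left inner_diff_right field_simps inner_commute)
qed

section \<open>Second moments on the sphere relative to an orthonormal set\<close>

context
  fixes B :: "(real^'n) set"
  assumes fin: "finite B" and orth: "pairwise orthogonal B" and unit: "\<And>b. b \<in> B \<Longrightarrow> norm b = 1"
begin

lemma orthonormal_inner: "b \<in> B \<Longrightarrow> a \<in> B \<Longrightarrow> b \<bullet> a = (if a = b then 1 else 0)"
  using orth unit[of b] by (auto simp: pairwise_def orthogonal_def dot_square_norm)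

lemma orthonormal_product_bound:
  assumes "a \<in> B" "b \<in> B"
  shows "\<bar>(u \<bullet> a) * (u \<bullet> b)\<bar> \<le> (\<Sum>c\<in>B. (u \<bullet> c)\<^sup>2)"
proof -
  let ?N = "\<Sum>c\<in>B. (u \<bullet> c)\<^sup>2"
  have "(u \<bullet> c)\<^sup>2 \<le> ?N" if "c \<in> B" for c
    using that fin by (intro member_le_sum) auto
  from mult_mono[OF this[OF assms(1)] this[OF assms(2)]]
  have "\<bar>(u \<bullet> a) * (u \<bullet> b)\<bar>\<^sup>2 \<le> ?N\<^sup>2"
    by (simp add: power2_eq_square sum_nonneg mult_ac)
  then show ?thesis
    by (rule power2_le_imp_le) (simp add: sum_nonneg)
qed

text \<open>The quotient is bounded by 1, also where the denominator vanishes and division yields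
  0.\<close>

lemma integrable_sphere_product:
  assumes "a \<in> B" "b \<in> B"
  shows "integrable unif_sphere (\<lambda>u. (u \<bullet> a) * (u \<bullet> b) / (\<Sum>c\<in>B. (u \<bullet> c)\<^sup>2))"
proof -
  interpret prob_space "unif_sphere :: (real^'n) measure" by (rule prob_space_unif_sphere)
  have "\<bar>(u \<bullet> a) * (u \<bullet> b)\<bar> / (\<Sum>c\<in>B. (u \<bullet> c)\<^sup>2) \<le> 1" for u
    using orthonormal_product_bound[OF assms, of u]
    by (cases "(\<Sum>c\<in>B. (u \<bullet> c)\<^sup>2) = 0") (auto simp: divide_le_eq sum_nonneg less_le)
  then show ?thesis
    by (intro integrable_const_bound[of _ 1]) (auto simp: abs_divide sum_nonneg)
qed

text \<open>A reflection that permutes the coordinates along \<open>B\<close> up to sign leaves the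
  normaliser unchanged. Invariance of the sphere measure then carries the effect on the numerator,
  including the sign \<open>s\<close>, over to the integral.\<close>

lemma sphere_product_reflect:
  assumes \<pi>: "\<And>u c. c \<in> B \<Longrightarrow> (reflection e u \<bullet> c)\<^sup>2 = (u \<bullet> \<pi> c)\<^sup>2" "bij_betw \<pi> B B"
    and ab: "\<And>u. (reflection e u \<bullet> a) * (reflection e u \<bullet> b) = s * ((u \<bullet> a') * (u \<bullet> b'))"
  shows "(\<integral>u. (u \<bullet> a) * (u \<bullet> b) / (\<Sum>c\<in>B. (u \<bullet> c)\<^sup>2) \<partial>unif_sphere)
    = s * (\<integral>u. (u \<bullet> a') * (u \<bullet> b') / (\<Sum>c\<in>B. (u \<bullet> c)\<^sup>2) \<partial>unif_sphere)"
proof -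
  have "(\<Sum>c\<in>B. (reflection e u \<bullet> c)\<^sup>2) = (\<Sum>c\<in>B. (u \<bullet> c)\<^sup>2)" for u
    using sum.reindex_bij_betw[OF \<pi>(2), of "\<lambda>c. (u \<bullet> c)\<^sup>2"] by (simp add: \<pi>(1))
  then show ?thesis
    using integral_unif_sphere_orthogonal[OF orthogonal_transformation_reflection[of e],
        of "\<lambda>u. (u \<bullet> a) * (u \<bullet> b) / (\<Sum>c\<in>B. (u \<bullet> c)\<^sup>2)"]
    by (simp add: ab flip: times_divide_eq_right)
qed

text \<open>Reflection along \<open>a\<close> flips only that coordinate, so the integral equals its
  own negative.\<close>

lemma sphere_product_off_diagonal:
  assumes "a \<in> B" "b \<in> B" "a \<noteq> b"
  shows "(\<integral>u. (u \<bullet> a) * (u \<bullet> b) / (\<Sum>c\<in>B. (u \<bullet> c)\<^sup>2) \<partial>unif_sphere) = 0"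
proof -
  have "reflection a u \<bullet> c = (if c = a then - (u \<bullet> c) else u \<bullet> c)" if "c \<in> B" for u c
    using assms that by (simp add: reflection_def inner_diff_left orthonormal_inner)
  moreover have "bij_betw (\<lambda>c. c) B B" by (simp add: bij_betw_def)
  ultimately show ?thesis
    using sphere_product_reflect[of a "\<lambda>c. c" a b "-1" a b] assms by simp
qed

text \<open>Reflection along \<open>a - b\<close> exchanges \<open>a\<close> and \<open>b\<close>
  and fixes the rest of \<open>B\<close>.\<close>

lemma sphere_product_diagonal_eq:
  assumes "a \<in> B" "b \<in> B"
  shows "(\<integral>u. (u \<bullet> a) * (u \<bullet> a) / (\<Sum>c\<in>B. (u \<bullet> c)\<^sup>2) \<partial>unif_sphere)
    = (\<integral>u. (u \<bullet> b) * (u \<bullet> b) / (\<Sum>c\<in>B. (u \<bullet> c)\<^sup>2) \<partial>unif_sphere)"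
proof (cases "a = b")
  case False
  have "bij_betw (Transposition.transpose a b) B B"
    using assms by (auto intro!: bij_betw_byWitness[where f' = "Transposition.transpose a b"]
        simp: Transposition.transpose_def)
  moreover have "reflection (a - b) u \<bullet> c = u \<bullet> Transposition.transpose a b c" if "c \<in> B" for u c
    using assms False that
    by (auto simp: reflection_def inner_diff_left inner_diff_right orthonormal_inner
        Transposition.transpose_def diff_divide_distrib)
  ultimately show ?thesis
    using sphere_product_reflect[of "a - b" "Transposition.transpose a b" a a 1 b b] assms by simp
qed simp

text \<open>The integrals for the members of \<open>B\<close> are all equal, and their integrands
  sum to 1 almost everywhere.\<close>

lemma sphere_product_diagonal:
  assumes "b \<in> B"
  shows "(\<integral>u. (u \<bullet> b) * (u \<bullet> b) / (\<Sum>c\<in>B. (u \<bullet> c)\<^sup>2) \<partial>unif_sphere) = 1 / card B"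
proof -
  interpret prob_space "unif_sphere :: (real^'n) measure" by (rule prob_space_unif_sphere)
  let ?N = "\<lambda>u. \<Sum>c\<in>B. (u \<bullet> c)\<^sup>2"
  have "b \<noteq> 0" using unit[OF assms] by auto
  have "card B * (\<integral>u. (u \<bullet> b) * (u \<bullet> b) / ?N u \<partial>unif_sphere)
      = (\<Sum>a\<in>B. \<integral>u. (u \<bullet> a) * (u \<bullet> a) / ?N u \<partial>unif_sphere)"
    using sphere_product_diagonal_eq[OF _ assms] by simp
  also have "\<dots> = (\<integral>u. (\<Sum>a\<in>B. (u \<bullet> a) * (u \<bullet> a) / ?N u) \<partial>unif_sphere)"
    by (intro Bochner_Integration.integral_sum[symmetric] integrable_sphere_product)
  also have "\<dots> = (\<integral>u. 1 \<partial>(unif_sphere :: (real^'n) measure))"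
  proof (rule integral_cong_AE)
    \<comment> \<open>Where the normaliser is 0 the sum is 0 instead of 1; this is confined to
      \<open>b \<bullet> u = 0\<close>, a null set.\<close>
    show "AE u in unif_sphere. (\<Sum>a\<in>B. (u \<bullet> a) * (u \<bullet> a) / ?N u) = 1"
      using AE_unif_sphere_inner_nonzero[OF \<open>b \<noteq> 0\<close>]
    proof eventually_elim
      case (elim u)
      then have "0 < (u \<bullet> b)\<^sup>2" by (simp add: inner_commute)
      also have "\<dots> \<le> ?N u" using fin assms by (intro member_le_sum) auto
      finally show ?case by (simp add: power2_eq_square flip: sum_divide_distrib)
    qed
  qed auto
  also have "\<dots> = 1" by (simp add: prob_space)
  finally show ?thesis
    using fin assms by (subst eq_divide_eq) (auto simp: mult.commute)
qed

context
  fixes R :: "real^'n^'n"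
  assumes sym: "transpose R = R" and range: "range ((*v) R) \<subseteq> span B"
begin

lemma orthonormal_inner_expand: "x \<bullet> (R *v y) = (\<Sum>b\<in>B. (x \<bullet> b) * (b \<bullet> (R *v y)))"
proof -
  have "R *v y = (\<Sum>b\<in>B. ((R *v y) \<bullet> b) *\<^sub>R b)"
    using range by (intro orthonormal_basis_expand[symmetric] orth unit fin) auto
  then have "x \<bullet> (R *v y) = x \<bullet> (\<Sum>b\<in>B. ((R *v y) \<bullet> b) *\<^sub>R b)" by simp
  then show ?thesis by (simp add: inner_sum_right inner_commute mult.commute)
qed

lemma quadratic_form_orthonormal:
  "x \<bullet> (R *v y) = (\<Sum>a\<in>B. \<Sum>b\<in>B. (x \<bullet> a) * (y \<bullet> b) * (a \<bullet> (R *v b)))"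
proof -
  have *: "a \<bullet> (R *v y) = (\<Sum>b\<in>B. (y \<bullet> b) * (a \<bullet> (R *v b)))" for a
    using orthonormal_inner_expand[of y a] symmetric_swap[OF sym]
    by (metis (no_types, lifting) inner_commute sum.cong)
  show ?thesis
    unfolding orthonormal_inner_expand[of x y] unfolding * by (simp add: sum_distrib_left mult.assoc)
qed

text \<open>Expanding every diagonal entry in \<open>B\<close> and summing over the coordinates
  first produces the inner products \<open>a \<bullet> b\<close>, so only \<open>a = b\<close>
  survives.\<close>

lemma trace_orthonormal: "trace R = (\<Sum>b\<in>B. b \<bullet> (R *v b))"
proof -
  have "trace R = (\<Sum>i\<in>UNIV. \<Sum>a\<in>B. \<Sum>b\<in>B. (a $ i * b $ i) * (a \<bullet> (R *v b)))"
    unfolding trace_eq_sum_axis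
    by (subst quadratic_form_orthonormal) (simp add: inner_axis')
  also have "\<dots> = (\<Sum>a\<in>B. \<Sum>b\<in>B. \<Sum>i\<in>UNIV. (a $ i * b $ i) * (a \<bullet> (R *v b)))"
    by (subst sum.swap, intro sum.cong refl, rule sum.swap)
  also have "\<dots> = (\<Sum>a\<in>B. \<Sum>b\<in>B. (a \<bullet> b) * (a \<bullet> (R *v b)))"
    by (simp add: inner_vec_def sum_distrib_right)
  also have "\<dots> = (\<Sum>a\<in>B. a \<bullet> (R *v a))"
    using fin by (intro sum.cong refl) (simp add: orthonormal_inner if_distrib if_distribR cong: if_cong)
  finally show ?thesis .
qed

text \<open>In the expansion over \<open>B\<close> the mixed second moments vanish and each diagonal
  one is \<open>1 / card B\<close>, which leaves the trace.\<close>

lemma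
  assumes "B \<noteq> {}"
  shows integrable_sphere_quadratic:
      "integrable unif_sphere (\<lambda>u. (u \<bullet> (R *v u)) / (\<Sum>c\<in>B. (u \<bullet> c)\<^sup>2))"
    and sphere_quadratic_mean:
      "(\<integral>u. (u \<bullet> (R *v u)) / (\<Sum>c\<in>B. (u \<bullet> c)\<^sup>2) \<partial>unif_sphere) = trace R / card B"
proof -
  let ?N = "\<lambda>u. \<Sum>c\<in>B. (u \<bullet> c)\<^sup>2"
  let ?q = "\<lambda>a b u. (u \<bullet> a) * (u \<bullet> b) / ?N u"
  have eq: "(u \<bullet> (R *v u)) / ?N u = (\<Sum>a\<in>B. \<Sum>b\<in>B. ?q a b u * (a \<bullet> (R *v b)))" for u
    by (subst quadratic_form_orthonormal) (simp add: sum_divide_distrib)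
  show "integrable unif_sphere (\<lambda>u. (u \<bullet> (R *v u)) / ?N u)"
    unfolding eq by (intro Bochner_Integration.integrable_sum integrable_mult_left
        integrable_sphere_product)
  have "(\<integral>u. (u \<bullet> (R *v u)) / ?N u \<partial>unif_sphere)
      = (\<Sum>a\<in>B. \<integral>u. (\<Sum>b\<in>B. ?q a b u * (a \<bullet> (R *v b))) \<partial>unif_sphere)"
    unfolding eq by (intro Bochner_Integration.integral_sum Bochner_Integration.integrable_sum
        integrable_mult_left integrable_sphere_product)
  also have "\<dots> = (\<Sum>a\<in>B. \<Sum>b\<in>B. \<integral>u. ?q a b u * (a \<bullet> (R *v b)) \<partial>unif_sphere)"
    by (intro sum.cong refl Bochner_Integration.integral_sum integrable_mult_left
        integrable_sphere_product)
  also have "\<dots> = (\<Sum>a\<in>B. \<Sum>b\<in>B. (\<integral>u. ?q a b u \<partial>unif_sphere) * (a \<bullet> (R *v b)))"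
    by (intro sum.cong refl integral_mult_left_zero)
  also have "\<dots> = (\<Sum>a\<in>B. \<Sum>b\<in>B. (if b = a then 1 / card B * (a \<bullet> (R *v b)) else 0))"
    by (intro sum.cong refl) (auto simp: sphere_product_diagonal sphere_product_off_diagonal)
  also have "\<dots> = trace R / card B"
    using fin by (simp add: trace_orthonormal sum_divide_distrib)
  finally show "(\<integral>u. (u \<bullet> (R *v u)) / ?N u \<partial>unif_sphere) = trace R / card B" .
qed

end

end

lemma inner_self_Basis: "(\<Sum>b\<in>Basis. (u \<bullet> b)\<^sup>2) = u \<bullet> (u :: 'a::euclidean_space)"
  by (simp add: euclidean_inner[of u u] power2_eq_square)

lemma sphere_rayleigh_mean:
  fixes Q :: "real^'n^'n"
  assumes "transpose Q = Q"
  shows "(\<integral>w. (w \<bullet> (Q *v w)) / (w \<bullet> w) \<partial>unif_sphere) = trace Q / CARD('n)"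
  using sphere_quadratic_mean[of Basis Q] assms
  by (simp add: inner_self_Basis pairwise_def orthogonal_def inner_Basis)

text \<open>The deflated matrix still has nonnegative trace. This bound makes the decrease
  integrable over random directions.\<close>

lemma deflation_le_trace: "psd R \<Longrightarrow> (norm (R *v u))\<^sup>2 / (u \<bullet> (R *v u)) \<le> trace R"
  using psd_trace_nonneg[OF psd_deflate, of R u] by (simp add: trace_deflate)

text \<open>With \<open>P\<close> the orthogonal projection onto the range of \<open>R\<close>, the Cauchy--Schwarz inequality
  bounds the integrand from below by \<open>u\<^sup>T R u / |P u|\<^sup>2\<close>.\<close>

lemma sphere_deflation_mean:
  fixes R :: "real^'n^'n"
  assumes R: "psd R" and "R \<noteq> 0"
  shows "trace R / dim (range ((*v) R))
    \<le> (\<integral>u. (norm (R *v u))\<^sup>2 / (u \<bullet> (R *v u)) \<partial>unif_sphere)"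
proof -
  interpret prob_space "unif_sphere :: (real^'n) measure" by (rule prob_space_unif_sphere)
  have "subspace (range ((*v) R))"
    by (intro linear_subspace_image matrix_vector_mul_linear subspace_UNIV)
  from orthonormal_basis_subspace[OF this]
  obtain B where B: "pairwise orthogonal B" "\<And>b. b \<in> B \<Longrightarrow> norm b = 1" "independent B"
    "card B = dim (range ((*v) R))" "span B = range ((*v) R)"
    by metis
  have fin: "finite B" by (rule independent_imp_finite[OF B(3)])
  have "B \<noteq> {}"
  proof
    assume "B = {}"
    then have "R *v u = 0" for u using B(5) by auto
    then show False using \<open>R \<noteq> 0\<close> by (simp add: matrix_eq)
  qed
  note ctx = fin B(1,2) psd_transpose[OF R] equalityD2[OF B(5)]
  let ?N = "\<lambda>u. \<Sum>b\<in>B. (u \<bullet> b)\<^sup>2"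
  have le: "(u \<bullet> (R *v u)) / ?N u \<le> (norm (R *v u))\<^sup>2 / (u \<bullet> (R *v u))" for u
  proof (cases "u \<bullet> (R *v u) = 0")
    case False
    let ?y = "R *v u"
    have pos: "0 < u \<bullet> ?y" using False psd_nonneg[OF R, of u] by simp
    have "(u \<bullet> ?y)\<^sup>2 = (\<Sum>b\<in>B. (u \<bullet> b) * (b \<bullet> ?y))\<^sup>2"
      by (subst orthonormal_inner_expand[OF ctx]) simp_all
    also have "\<dots> \<le> ?N u * (\<Sum>b\<in>B. (b \<bullet> ?y)\<^sup>2)"
      by (rule Cauchy_Schwarz_ineq_sum)
    \<comment> \<open>Parseval's identity, from the expansion with \<open>?y\<close> in both
      arguments; it is available because \<open>?y\<close> lies in the span of
      \<open>B\<close>.\<close>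
    also have "(\<Sum>b\<in>B. (b \<bullet> ?y)\<^sup>2) = ?y \<bullet> ?y"
      using orthonormal_inner_expand[OF ctx, of "?y" u]
      by (simp add: power2_eq_square inner_commute)
    finally have *: "(u \<bullet> ?y)\<^sup>2 \<le> ?N u * (norm ?y)\<^sup>2"
      by (simp add: dot_square_norm)
    then have "?N u \<noteq> 0" using pos by auto
    then have "0 < ?N u" by (simp add: less_le sum_nonneg)
    then show ?thesis using pos * by (simp add: field_simps power2_eq_square)
  qed simp
  have "trace R / dim (range ((*v) R)) = (\<integral>u. (u \<bullet> (R *v u)) / ?N u \<partial>unif_sphere)"
    using sphere_quadratic_mean[OF ctx \<open>B \<noteq> {}\<close>] by (simp add: B(4))
  also have "\<dots> \<le> (\<integral>u. (norm (R *v u))\<^sup>2 / (u \<bullet> (R *v u)) \<partial>unif_sphere)"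
  proof (rule integral_mono[OF integrable_sphere_quadratic[OF ctx \<open>B \<noteq> {}\<close>] _ le])
    have [measurable]: "(*v) R \<in> borel_measurable borel"
      by (intro borel_measurable_linear matrix_vector_mul_linear)
    show "integrable unif_sphere (\<lambda>u. (norm (R *v u))\<^sup>2 / (u \<bullet> (R *v u)))"
      using deflation_le_trace[OF R]
      by (intro integrable_const_bound[of _ "trace R"]) (auto simp: psd_nonneg[OF R])
  qed
  finally show ?thesis .
qed

section \<open>Conditioning on the past\<close>

lemma borel_measurable_vec_nth [measurable (raw)]:
  fixes f :: "'w \<Rightarrow> 'a::euclidean_space^'n"
  assumes "f \<in> borel_measurable M"
  shows "(\<lambda>\<omega>. f \<omega> $ i) \<in> borel_measurable M"
  by (rule measurable_compose[OF assms])
    (intro borel_measurable_linear linearI; simp)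

lemma borel_measurable_vec_lambda [measurable (raw)]:
  fixes f :: "'w \<Rightarrow> 'n::finite \<Rightarrow> 'a::euclidean_space"
  assumes "\<And>i. (\<lambda>\<omega>. f \<omega> i) \<in> borel_measurable M"
  shows "(\<lambda>\<omega>. \<chi> i. f \<omega> i) \<in> borel_measurable M"
  using assms by (subst borel_measurable_euclidean_space) (auto simp: Basis_vec_def inner_axis)

lemma borel_measurable_matrix_vector_mult [measurable (raw)]:
  fixes A :: "'w \<Rightarrow> real^'n^'m"
  assumes [measurable]: "A \<in> borel_measurable M" "x \<in> borel_measurable M"
  shows "(\<lambda>\<omega>. A \<omega> *v x \<omega>) \<in> borel_measurable M"
  unfolding matrix_vector_mult_def by measurable

lemma borel_measurable_matrix_matrix_mult [measurable (raw)]: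
  fixes A :: "'w \<Rightarrow> real^'n^'m" and B :: "'w \<Rightarrow> real^'k^'n"
  assumes [measurable]: "A \<in> borel_measurable M" "B \<in> borel_measurable M"
  shows "(\<lambda>\<omega>. A \<omega> ** B \<omega>) \<in> borel_measurable M"
  unfolding matrix_matrix_mult_def by measurable

lemma borel_measurable_transpose [measurable (raw)]:
  fixes A :: "'w \<Rightarrow> real^'n^'m"
  assumes [measurable]: "A \<in> borel_measurable M"
  shows "(\<lambda>\<omega>. transpose (A \<omega>)) \<in> borel_measurable M"
  unfolding Finite_Cartesian_Product.transpose_def by measurable

lemma borel_measurable_trace [measurable (raw)]:
  fixes A :: "'w \<Rightarrow> real^'n^'n"
  assumes [measurable]: "A \<in> borel_measurable M"
  shows "(\<lambda>\<omega>. trace (A \<omega>)) \<in> borel_measurable M"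
  unfolding trace_def by measurable

lemma borel_measurable_outer [measurable (raw)]:
  fixes u v :: "'w \<Rightarrow> real^'n"
  assumes [measurable]: "u \<in> borel_measurable M" "v \<in> borel_measurable M"
  shows "(\<lambda>\<omega>. outer (u \<omega>) (v \<omega>)) \<in> borel_measurable M"
  unfolding outer_def by measurable

lemma borel_measurable_deflate [measurable (raw)]:
  fixes R :: "'w \<Rightarrow> real^'n^'n"
  assumes [measurable]: "R \<in> borel_measurable M" "u \<in> borel_measurable M"
  shows "(\<lambda>\<omega>. deflate (R \<omega>) (u \<omega>)) \<in> borel_measurable M"
  unfolding deflate_def by measurable

lemma borel_measurable_BFGS [measurable (raw)]:
  fixes G :: "'w \<Rightarrow> real^'n^'n"
  assumes [measurable]: "G \<in> borel_measurable M" "u \<in> borel_measurable M"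
  shows "(\<lambda>\<omega>. BFGS (G \<omega>) A (u \<omega>)) \<in> borel_measurable M"
  unfolding BFGS_def by measurable

lemma borel_measurable_BFGS_factor [measurable (raw)]:
  fixes K :: "'w \<Rightarrow> real^'n^'n"
  assumes [measurable]: "K \<in> borel_measurable M" "u \<in> borel_measurable M" "w \<in> borel_measurable M"
  shows "(\<lambda>\<omega>. BFGS_factor (K \<omega>) A (u \<omega>) (w \<omega>)) \<in> borel_measurable M"
  unfolding BFGS_factor_def Let_def by measurable

text \<open>This names the sigma-algebra from \<open>random_directions\<close>, so that an iterate
  can be said to depend on the past only.\<close>

definition past_algebra :: "'w measure \<Rightarrow> ('w \<Rightarrow> 'h::topological_space) \<Rightarrow>
    (nat \<Rightarrow> 'w \<Rightarrow> 'a::euclidean_space) \<Rightarrow> nat \<Rightarrow> 'w measure" where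
  "past_algebra M H U k = vimage_algebra (space M) (\<lambda>\<omega>. (H \<omega>, \<lambda>i\<in>{..<k}. U i \<omega>))
     (borel \<Otimes>\<^sub>M Pi\<^sub>M {..<k} (\<lambda>_. borel))"

lemma space_past_algebra [simp]: "space (past_algebra M H U k) = space M"
  by (simp add: past_algebra_def)

lemma
  shows measurable_past_initial: "H \<in> borel_measurable (past_algebra M H U k)"
    and measurable_past_direction: "i < k \<Longrightarrow> U i \<in> borel_measurable (past_algebra M H U k)"
proof -
  have *: "(\<lambda>\<omega>. (H \<omega>, \<lambda>i\<in>{..<k}. U i \<omega>))
      \<in> past_algebra M H U k \<rightarrow>\<^sub>M borel \<Otimes>\<^sub>M Pi\<^sub>M {..<k} (\<lambda>_. borel)"
    unfolding past_algebra_def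
    by (rule measurable_vimage_algebra1) (auto simp: space_pair_measure space_PiM)
  show "H \<in> borel_measurable (past_algebra M H U k)"
    using measurable_compose[OF * measurable_fst] by simp
  assume "i < k"
  then show "U i \<in> borel_measurable (past_algebra M H U k)"
    using measurable_compose[OF measurable_compose[OF * measurable_snd]
        measurable_component_singleton[of i "{..<k}"]] by simp
qed

lemma sets_past_algebra:
  assumes "random_directions M H U"
  shows "sets (past_algebra M H U k) \<subseteq> sets M"
proof -
  have [measurable]: "H \<in> borel_measurable M" "\<And>k. U k \<in> borel_measurable M"
    using assms by (auto simp: random_directions_def)
  show ?thesis
    unfolding past_algebra_def by (rule sets_image_in_sets) (rule refl, measurable)
qed

lemma measurable_past_algebra:
  assumes "random_directions M H U" "X \<in> borel_measurable (past_algebra M H U k)"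
  shows "X \<in> borel_measurable M"
  using assms(2) sets_past_algebra[OF assms(1), of k] by (auto simp: measurable_def)

text \<open>By independence the joint law of a past quantity \<open>X\<close> and the direction
  \<open>U k\<close> is a product with the sphere measure, so Fubini's theorem averages over the
  direction with \<open>X\<close> held fixed.\<close>

lemma
  fixes f :: "'b::topological_space \<times> 'a::euclidean_space \<Rightarrow> real"
  assumes M: "prob_space M" and rd: "random_directions M H U"
    and X: "X \<in> borel_measurable (past_algebra M H U k)"
    and f: "f \<in> borel_measurable (borel \<Otimes>\<^sub>M borel)"
    and int: "integrable M (\<lambda>\<omega>. f (X \<omega>, U k \<omega>))"
  shows expectation_freeze_past:
      "(\<integral>\<omega>. f (X \<omega>, U k \<omega>) \<partial>M) = (\<integral>\<omega>. (\<integral>s. f (X \<omega>, s) \<partial>unif_sphere) \<partial>M)"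
    and integrable_freeze_past:
      "integrable M (\<lambda>\<omega>. \<integral>s. f (X \<omega>, s) \<partial>unif_sphere)"
proof -
  interpret prob_space M by (rule M)
  have U [measurable]: "U k \<in> borel_measurable M" and law: "distr M borel (U k) = unif_sphere"
    and indep: "indep_set (sets (past_algebra M H U k)) (sets (vimage_algebra (space M) (U k) borel))"
    using rd by (auto simp: random_directions_def past_algebra_def)
  have XM [measurable]: "X \<in> borel_measurable M"
    by (rule measurable_past_algebra[OF rd X])
  interpret X: prob_space "distr M borel X" by (rule prob_space_distr) measurable
  interpret S: prob_space "unif_sphere :: 'a measure" by (rule prob_space_unif_sphere)
  interpret P: pair_sigma_finite "distr M borel X" "unif_sphere :: 'a measure" ..
  have joint: "distr M borel X \<Otimes>\<^sub>M unif_sphere = distr M (borel \<Otimes>\<^sub>M borel) (\<lambda>\<omega>. (X \<omega>, U k \<omega>))"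
  proof (rule pair_measure_eqI)
    fix A B assume "A \<in> sets (distr M borel X)" "B \<in> sets (unif_sphere :: 'a measure)"
    then have [measurable]: "A \<in> sets borel" "B \<in> sets borel" by auto
    have "X -` A \<inter> space M \<in> sets (past_algebra M H U k)"
      using measurable_sets[OF X, of A] by simp
    moreover have "U k -` B \<inter> space M \<in> sets (vimage_algebra (space M) (U k) borel)"
      by (rule in_vimage_algebra) simp
    ultimately have "prob ((X -` A \<inter> space M) \<inter> (U k -` B \<inter> space M))
        = prob (X -` A \<inter> space M) * prob (U k -` B \<inter> space M)"
      using indep unfolding indep_sets2_eq by blast
    then show "emeasure (distr M borel X) A * emeasure unif_sphere B
        = emeasure (distr M (borel \<Otimes>\<^sub>M borel) (\<lambda>\<omega>. (X \<omega>, U k \<omega>))) (A \<times> B)"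
      unfolding law[symmetric]
      by (simp add: emeasure_distr emeasure_eq_measure vimage_def Collect_conj_eq Int_ac
          flip: ennreal_mult)
  qed (simp_all add: X.sigma_finite_measure_axioms S.sigma_finite_measure_axioms
      cong: sets_pair_measure_cong)
  have int': "integrable (distr M borel X \<Otimes>\<^sub>M unif_sphere) f"
    unfolding joint using int f by (subst integrable_distr_eq) auto
  have "integrable (distr M borel X) (\<lambda>x. \<integral>s. f (x, s) \<partial>unif_sphere)"
    by (rule P.integrable_fst'[OF int'])
  then show "integrable M (\<lambda>\<omega>. \<integral>s. f (X \<omega>, s) \<partial>unif_sphere)"
    by (rule integrable_distr[OF XM])
  have [measurable]: "(\<lambda>x. \<integral>s. f (x, s) \<partial>unif_sphere) \<in> borel_measurable borel"
    using P.integrable_fst'[OF int'] by (simp add: integrable_iff_bounded)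
  have "(\<integral>\<omega>. f (X \<omega>, U k \<omega>) \<partial>M) = (\<integral>z. f z \<partial>(distr M borel X \<Otimes>\<^sub>M unif_sphere))"
    unfolding joint using f by (subst integral_distr) auto
  also have "\<dots> = (\<integral>x. (\<integral>s. f (x, s) \<partial>unif_sphere) \<partial>distr M borel X)"
    by (rule P.integral_fst'[OF int', symmetric])
  also have "\<dots> = (\<integral>\<omega>. (\<integral>s. f (X \<omega>, s) \<partial>unif_sphere) \<partial>M)"
    by (rule integral_distr) measurable
  finally show "(\<integral>\<omega>. f (X \<omega>, U k \<omega>) \<partial>M) = (\<integral>\<omega>. (\<integral>s. f (X \<omega>, s) \<partial>unif_sphere) \<partial>M)" .
qed

section \<open>Decay of the traces\<close>

text \<open>The step factors \<open>(d - k - 1) / (d - k)\<close> telescope to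
  \<open>(d - k) / d\<close>.\<close>

lemma linear_decay:
  fixes t :: "nat \<Rightarrow> real"
  assumes "0 < d" and mono: "\<And>k. t (Suc k) \<le> t k"
    and decay: "\<And>k. k < d \<Longrightarrow> t (Suc k) \<le> t k - t k / real (d - k)"
  shows "t k \<le> max 0 (1 - real k / real d) * t 0"
proof (induction k)
  case 0
  then show ?case using assms(1) by simp
next
  case (Suc k)
  show ?case
  proof (cases "k < d")
    case True
    define r where "r = real (d - k)"
    have r: "real k = real d - r" "1 \<le> r" using True by (auto simp: r_def of_nat_diff)
    have "t (Suc k) \<le> t k * ((r - 1) / r)"
      using decay[OF True] r(2) by (simp add: r_def[symmetric] field_simps)
    also have "\<dots> \<le> (r / d * t 0) * ((r - 1) / r)"
      using Suc.IH r assms(1) by (intro mult_right_mono) (auto simp: diff_divide_distrib)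
    also have "\<dots> = (r - 1) / d * t 0"
      using r(2) by simp
    also have "(r - 1) / d = max 0 (1 - real (Suc k) / real d)"
      using r assms(1) divide_right_mono[OF r(2), of "real d"]
      by (simp add: diff_divide_distrib add_divide_distrib)
    finally show ?thesis .
  next
    case False
    \<comment> \<open>From index \<open>d\<close> on the bound is 0, and monotonicity alone
      preserves it.\<close>
    then have "max 0 (1 - real k / real d) = 0" "max 0 (1 - real (Suc k) / real d) = 0"
      using assms(1) by (auto simp: field_simps)
    then show ?thesis using Suc.IH mono[of k] by simp
  qed
qed

lemma greedy_directionE:
  assumes "greedy_direction Q u"
  obtains i where "u = axis i 1" "\<And>j. axis j 1 \<bullet> (Q *v axis j 1) \<le> u \<bullet> (Q *v u)"
proof -
  from assms obtain i where i: "u = axis i 1"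
    and le: "\<And>v. v \<in> range (\<lambda>i. axis i 1) \<Longrightarrow> v \<bullet> (Q *v v) \<le> u \<bullet> (Q *v u)"
    unfolding greedy_direction_def is_arg_max_linorder by blast
  show thesis by (rule that[OF i le]) simp
qed

text \<open>The indices of the nonzero columns. Their number takes the place of the rank when the
  directions are basis vectors.\<close>

definition support :: "real^'n^'n \<Rightarrow> 'n set" where
  "support R = {i. R *v axis i 1 \<noteq> 0}"

lemma greedy_trace_le:
  assumes "greedy_direction R u"
  shows "trace R \<le> card (support R) * (u \<bullet> (R *v u))"
proof -
  obtain i where i: "u = axis i 1" "\<And>j. axis j 1 \<bullet> (R *v axis j 1) \<le> u \<bullet> (R *v u)"
    using greedy_directionE[OF assms] by blast
  have "trace R = (\<Sum>j\<in>support R. axis j 1 \<bullet> (R *v axis j 1))"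
    unfolding trace_eq_sum_axis by (rule sum.mono_neutral_right) (auto simp: support_def)
  also have "\<dots> \<le> card (support R) * (u \<bullet> (R *v u))"
    using sum_bounded_above[of "support R" _ "u \<bullet> (R *v u)"] i(2) by simp
  finally show ?thesis .
qed

text \<open>For a unit vector, Cauchy-Schwarz gives a decrease of at least
  \<open>u \<bullet> (R *v u)\<close>, the largest diagonal entry. That entry is at least the
  average over the nonzero columns.\<close>

lemma greedy_deflation_ge:
  assumes R: "psd R" and u: "greedy_direction R u" and card: "card (support R) \<le> r"
  shows "trace R / r \<le> (norm (R *v u))\<^sup>2 / (u \<bullet> (R *v u))"
proof (cases "R *v u = 0")
  case True
  then have "trace R \<le> 0" using greedy_trace_le[OF u] by simp
  then show ?thesis using psd_trace_nonneg[OF R] by (simp add: True)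
next
  case False
  let ?q = "u \<bullet> (R *v u)"
  have q: "0 < ?q" by (rule psd_pos[OF R False])
  obtain i where "u = axis i 1" using greedy_directionE[OF u] by blast
  then have "norm u = 1" by simp
  then have "?q\<^sup>2 \<le> (norm (R *v u))\<^sup>2"
    using Cauchy_Schwarz_ineq[of u "R *v u"] by (simp add: dot_square_norm)
  then have "?q \<le> (norm (R *v u))\<^sup>2 / ?q"
    using q by (simp add: le_divide_eq power2_eq_square)
  moreover have "trace R \<le> r * ?q"
    using greedy_trace_le[OF u] card q by (meson mult_right_mono less_imp_le of_nat_mono order_trans)
  then have "trace R / r \<le> ?q"
    \<comment> \<open>For \<open>r = 0\<close> the quotient is 0 by convention; this case occurs
      once all dimensions are used up.\<close>
    using q by (cases "r = 0") (auto simp: divide_le_eq mult.commute)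
  ultimately show ?thesis by linarith
qed

text \<open>Kernel vectors of \<open>R\<close> stay in the kernel, so no new nonzero column appears,
  and the chosen column vanishes.\<close>

lemma card_support_deflate:
  assumes R: "psd R" and u: "greedy_direction R u" and card: "card (support R) \<le> r"
  shows "card (support (deflate R u)) \<le> r - 1"
proof -
  obtain i where i: "u = axis i 1" using greedy_directionE[OF u] by blast
  have sub: "support (deflate R u) \<subseteq> support R - {i}"
    using deflate_kernel[OF R] deflate_direction[OF R, of u] by (auto simp: support_def i)
  show ?thesis
  proof (cases "i \<in> support R")
    case True
    then show ?thesis using card_mono[OF _ sub] card by simp
  next
    case False
    then have "R *v u = 0" by (simp add: support_def i)
    \<comment> \<open>If the greedy column is already zero, the maximal diagonal entry is 0, which
      forces the whole support to be empty.\<close>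
    then have "trace R \<le> 0" using greedy_trace_le[OF u] by simp
    then have "axis j 1 \<bullet> (R *v axis j 1) = 0" for j
      using psd_trace_nonneg[OF R] psd_nonneg[OF R]
      unfolding trace_eq_sum_axis
      by (metis (no_types, lifting) UNIV_I antisym finite sum_nonneg_eq_0_iff)
    then have "support R = {}" using psd_null_vector[OF R] by (simp add: support_def)
    then show ?thesis using sub by simp
  qed
qed

lemma greedy_SR1_decay:
  fixes R :: "nat \<Rightarrow> real^'n^'n"
  assumes R0: "psd (R 0)" and step: "\<And>k. R (Suc k) = deflate (R k) (u k)"
    and u: "\<And>k. greedy_direction (R k) (u k)"
  shows "trace (R k) \<le> max 0 (1 - real k / real CARD('n)) * trace (R 0)"
proof (rule linear_decay)
  have psd: "psd (R k)" for k
    by (induction k) (auto simp: R0 step intro: psd_deflate)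
  have card: "card (support (R k)) \<le> CARD('n) - k" for k
  proof (induction k)
    case (Suc k)
    then show ?case using card_support_deflate[OF psd u Suc] by (simp add: step)
  qed (simp add: card_mono)
  show "trace (R (Suc k)) \<le> trace (R k)" for k
    by (simp only: step trace_deflate_le[OF psd])
  show "trace (R (Suc k)) \<le> trace (R k) - trace (R k) / real (CARD('n) - k)" for k
    using greedy_deflation_ge[OF psd u card, of k] by (simp add: step trace_deflate)
qed simp

text \<open>Only an upper bound \<open>r\<close> of the rank is tracked along a run. The zero matrix
  is separated because its rank gives no positive denominator.\<close>

lemma sphere_deflation_mean_ge:
  fixes R :: "real^'n^'n"
  assumes R: "psd R" and r: "dim (range ((*v) R)) \<le> r"
  shows "trace R / r \<le> (\<integral>u. (norm (R *v u))\<^sup>2 / (u \<bullet> (R *v u)) \<partial>unif_sphere)"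
proof (cases "R = 0")
  case True
  then show ?thesis by (simp add: trace_def)
next
  case False
  then obtain u where "R *v u \<noteq> 0" by (metis matrix_eq matrix_vector_mult_0)
  from dim_range_deflate[OF R this] have "0 < dim (range ((*v) R))" by simp
  then have "trace R / r \<le> trace R / dim (range ((*v) R))"
    using r psd_trace_nonneg[OF R] by (intro divide_left_mono) auto
  then show ?thesis using sphere_deflation_mean[OF R False] by linarith
qed

text \<open>Freezing the past, a fixed nonzero matrix annihilates a uniform direction with
  probability 0; averaging over the past keeps this.\<close>

lemma AE_random_direction_kernel:
  fixes R :: "'w \<Rightarrow> real^'n^'n"
  assumes M: "prob_space M" and rd: "random_directions M H U"
    and R: "R \<in> borel_measurable (past_algebra M H U k)"
  shows "AE \<omega> in M. R \<omega> \<noteq> 0 \<longrightarrow> R \<omega> *v U k \<omega> \<noteq> 0"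
proof -
  interpret prob_space M by (rule M)
  \<comment> \<open>The indicator of the bad event, with norms reducing both tests to comparisons of
    reals.\<close>
  define f :: "(real^'n^'n) \<times> (real^'n) \<Rightarrow> real" where
    "f z = (if norm (fst z) \<noteq> 0 \<and> norm (fst z *v snd z) = 0 then 1 else 0)" for z
  have f [measurable]: "f \<in> borel_measurable (borel \<Otimes>\<^sub>M borel)"
    unfolding f_def by measurable
  have [measurable]: "R \<in> borel_measurable M" "U k \<in> borel_measurable M"
    using measurable_past_algebra[OF rd R] rd by (auto simp: random_directions_def)
  have int: "integrable M (\<lambda>\<omega>. f (R \<omega>, U k \<omega>))"
    by (intro integrable_const_bound[of _ 1]) (auto simp: f_def)
  have "(\<integral>s. f (X, s) \<partial>unif_sphere) = 0" for X
  proof (cases "X = 0")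
    case False
    have "AE s in unif_sphere. f (X, s) = 0"
      using AE_unif_sphere_mult_vec_nonzero[OF False] by eventually_elim (simp add: f_def)
    then show ?thesis by (rule integral_eq_zero_AE)
  qed (simp add: f_def)
  then have "(\<integral>\<omega>. f (R \<omega>, U k \<omega>) \<partial>M) = 0"
    by (simp add: expectation_freeze_past[OF M rd R f int])
  then have "AE \<omega> in M. f (R \<omega>, U k \<omega>) = 0"
    by (subst (asm) integral_nonneg_eq_0_iff_AE[OF int]) (auto simp: f_def)
  then show ?thesis by eventually_elim (auto simp: f_def split: if_splits)
qed

text \<open>\<open>linear_decay\<close> is applied to the expected traces: freezing the past turns
  the mean decrease on the sphere into a decrease in expectation.\<close>

lemma random_SR1_decay:
  fixes R :: "nat \<Rightarrow> 'w \<Rightarrow> real^'n^'n"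
  assumes M: "prob_space M" and rd: "random_directions M H U"
    and R0: "\<And>k. R 0 \<in> borel_measurable (past_algebra M H U k)"
    and psd0: "\<And>\<omega>. \<omega> \<in> space M \<Longrightarrow> psd (R 0 \<omega>)"
    and step: "\<And>\<omega> k. \<omega> \<in> space M \<Longrightarrow> R (Suc k) \<omega> = deflate (R k \<omega>) (U k \<omega>)"
    and int0: "integrable M (\<lambda>\<omega>. trace (R 0 \<omega>))"
  shows "integrable M (\<lambda>\<omega>. trace (R k \<omega>))"
    and "(\<integral>\<omega>. trace (R k \<omega>) \<partial>M)
      \<le> max 0 (1 - real k / real CARD('n)) * (\<integral>\<omega>. trace (R 0 \<omega>) \<partial>M)"
proof -
  interpret prob_space M by (rule M)
  have psd: "psd (R k \<omega>)" if "\<omega> \<in> space M" for k \<omega>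
    using that by (induction k) (auto simp: psd0 step intro: psd_deflate)
  have past: "R j \<in> borel_measurable (past_algebra M H U k)" if "j \<le> k" for j k
    using that
  proof (induction j)
    case (Suc j)
    then have [measurable]: "R j \<in> borel_measurable (past_algebra M H U k)"
      "U j \<in> borel_measurable (past_algebra M H U k)"
      by (auto intro: measurable_past_direction)
    have "(\<lambda>\<omega>. deflate (R j \<omega>) (U j \<omega>)) \<in> borel_measurable (past_algebra M H U k)"
      by measurable
    then show ?case by (subst measurable_cong[OF step]) simp_all
  qed (rule R0)
  have meas [measurable]: "R k \<in> borel_measurable M" "U k \<in> borel_measurable M" for k
    using measurable_past_algebra[OF rd past[of k k]] rd by (auto simp: random_directions_def)
  \<comment> \<open>A single null set for all steps allows the induction on the rank to run along
    one fixed sample.\<close>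
  have "AE \<omega> in M. \<forall>k. R k \<omega> \<noteq> 0 \<longrightarrow> R k \<omega> *v U k \<omega> \<noteq> 0"
    unfolding AE_all_countable by (intro allI AE_random_direction_kernel[OF M rd past]) simp
  then have rank: "AE \<omega> in M. dim (range ((*v) (R k \<omega>))) \<le> CARD('n) - k" for k
    using AE_space
  proof eventually_elim
    case (elim \<omega>)
    show ?case
    proof (induction k)
      case 0
      then show ?case using dim_subset_UNIV[of "range ((*v) (R 0 \<omega>))"] by simp
    next
      case (Suc k)
      show ?case
      proof (cases "R k \<omega> = 0")
        case True
        then have "R (Suc k) \<omega> = 0" by (simp add: step[OF elim(2)] deflate_trivial)
        then show ?thesis by (simp add: dim_range_zero)
      next
        case False
        then show ?thesis
          using dim_range_deflate[OF psd[OF elim(2)], of k "U k \<omega>"] elim(1) Suc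
          by (simp add: step[OF elim(2)])
      qed
    qed
  qed
  have le0: "trace (R k \<omega>) \<le> trace (R 0 \<omega>)" if "\<omega> \<in> space M" for k \<omega>
    by (induction k) (use that in \<open>auto simp: step intro: order_trans[OF trace_deflate_le[OF psd]]\<close>)
  show int: "integrable M (\<lambda>\<omega>. trace (R k \<omega>))" for k
    by (rule Bochner_Integration.integrable_bound[OF int0])
      (auto intro!: AE_I2 simp: psd_trace_nonneg psd le0)
  \<comment> \<open>The trace decrease as a function of matrix and direction, the shape required for
    freezing the past.\<close>
  define D :: "(real^'n^'n) \<times> (real^'n) \<Rightarrow> real" where
    "D z = (norm (fst z *v snd z))\<^sup>2 / (snd z \<bullet> (fst z *v snd z))" for z
  have D [measurable]: "D \<in> borel_measurable (borel \<Otimes>\<^sub>M borel)"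
    unfolding D_def by measurable
  have intD: "integrable M (\<lambda>\<omega>. D (R k \<omega>, U k \<omega>))" for k
    by (rule Bochner_Integration.integrable_bound[OF int[of k]])
      (auto intro!: AE_I2 simp: D_def psd_trace_nonneg psd deflation_le_trace psd_nonneg)
  have dec: "(\<integral>\<omega>. trace (R (Suc k) \<omega>) \<partial>M)
      = (\<integral>\<omega>. trace (R k \<omega>) \<partial>M) - (\<integral>\<omega>. D (R k \<omega>, U k \<omega>) \<partial>M)" for k
    unfolding Bochner_Integration.integral_diff[OF int intD, symmetric]
    by (intro Bochner_Integration.integral_cong refl) (simp add: step trace_deflate D_def)
  show "(\<integral>\<omega>. trace (R k \<omega>) \<partial>M)
      \<le> max 0 (1 - real k / real CARD('n)) * (\<integral>\<omega>. trace (R 0 \<omega>) \<partial>M)"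
  proof (rule linear_decay)
    show "(\<integral>\<omega>. trace (R (Suc k) \<omega>) \<partial>M) \<le> (\<integral>\<omega>. trace (R k \<omega>) \<partial>M)" for k
      by (rule integral_mono[OF int int]) (simp add: step trace_deflate_le psd)
    fix k
    have "(\<integral>\<omega>. trace (R k \<omega>) \<partial>M) / real (CARD('n) - k)
        = (\<integral>\<omega>. trace (R k \<omega>) / real (CARD('n) - k) \<partial>M)" by simp
    also have "\<dots> \<le> (\<integral>\<omega>. (\<integral>s. D (R k \<omega>, s) \<partial>unif_sphere) \<partial>M)"
    proof (rule integral_mono_AE)
      show "AE \<omega> in M. trace (R k \<omega>) / real (CARD('n) - k) \<le> (\<integral>s. D (R k \<omega>, s) \<partial>unif_sphere)"
        using rank[of k] AE_space
        by eventually_elim (simp add: D_def sphere_deflation_mean_ge psd)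
    qed (use int integrable_freeze_past[OF M rd past D intD] in auto)
    also have "\<dots> = (\<integral>\<omega>. D (R k \<omega>, U k \<omega>) \<partial>M)"
      by (rule expectation_freeze_past[OF M rd past D intD, symmetric]) simp
    finally show "(\<integral>\<omega>. trace (R (Suc k) \<omega>) \<partial>M)
        \<le> (\<integral>\<omega>. trace (R k \<omega>) \<partial>M) - (\<integral>\<omega>. trace (R k \<omega>) \<partial>M) / real (CARD('n) - k)"
      unfolding dec by simp
  qed simp
qed

section \<open>Geometric decay of the BFGS gap\<close>

lemma bfgs_gap_step:
  assumes A: "posdef A" and inv: "bfgs_invariant A G K" and w: "norm w = 1"
  shows "bfgs_gap A (BFGS G A (transpose K *v w))
    = bfgs_gap A G + 1 - w \<bullet> (bfgs_form A G K *v w)"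
proof -
  have "w \<noteq> 0" using w by auto
  then show ?thesis using bfgs_gap_update[OF A inv, of w] w by (simp add: dot_square_norm)
qed

lemma trace_bfgs_form_gap:
  fixes A :: "real^'n^'n"
  assumes "posdef A" "bfgs_invariant A G K"
  shows "trace (bfgs_form A G K) = bfgs_gap A G + CARD('n)"
  by (simp add: trace_bfgs_form[OF assms] bfgs_gap_def)

lemma greedy_BFGS_decay:
  fixes A :: "real^'n^'n" and G K :: "nat \<Rightarrow> real^'n^'n"
  assumes A: "posdef A" and inv: "\<And>k. bfgs_invariant A (G k) (K k)"
    and step: "\<And>k. G (Suc k) = BFGS (G k) A (transpose (K k) *v w k)"
    and w: "\<And>k. greedy_direction (bfgs_form A (G k) (K k)) (w k)"
  shows "bfgs_gap A (G k) \<le> (1 - 1 / real CARD('n)) ^ k * bfgs_gap A (G 0)"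
proof (induction k)
  case (Suc k)
  let ?d = "real CARD('n)" and ?Q = "bfgs_form A (G k) (K k)"
  have d: "1 \<le> ?d" by (simp add: Suc_leI)
  obtain i where i: "w k = axis i 1" using greedy_directionE[OF w] by blast
  have "trace ?Q \<le> card (support ?Q) * (w k \<bullet> (?Q *v w k))"
    by (rule greedy_trace_le[OF w])
  also have "\<dots> \<le> ?d * (w k \<bullet> (?Q *v w k))"
    by (intro mult_right_mono psd_nonneg[OF psd_bfgs_form[OF A inv]]) (simp add: card_mono)
  \<comment> \<open>The trace of \<open>?Q\<close> is the gap plus the dimension; divided by the
    dimension it yields the 1 that cancels the one in the update.\<close>
  finally have "bfgs_gap A (G k) / ?d + 1 \<le> w k \<bullet> (?Q *v w k)"
    using d by (simp add: trace_bfgs_form_gap[OF A inv] field_simps)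
  then have "bfgs_gap A (G (Suc k)) \<le> (1 - 1 / ?d) * bfgs_gap A (G k)"
    using bfgs_gap_step[OF A inv, of "w k" k] by (simp add: step i algebra_simps)
  also have "\<dots> \<le> (1 - 1 / ?d) * ((1 - 1 / ?d) ^ k * bfgs_gap A (G 0))"
    using d by (intro mult_left_mono Suc.IH) simp
  finally show ?case by simp
qed simp

lemma psd_quadratic_le_trace:
  fixes Q :: "real^'n^'n"
  assumes "psd Q"
  shows "v \<bullet> (Q *v v) \<le> trace Q * (v \<bullet> v)"
proof -
  have "matrix_inv (mat 1 :: real^'n^'n) = mat 1" by (rule matrix_inv_unique) simp
  then show ?thesis using quadratic_form_le_trace[OF posdef_mat_1 assms, of v] by simp
qed

text \<open>The update of the gap is exact and the mean Rayleigh quotient is known exactly, so the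
  expectation obeys an equality. The initial factor \<open>K 0\<close> belongs to the past because
  it enters every direction.\<close>

lemma random_BFGS_decay:
  fixes A :: "real^'n^'n" and G K :: "nat \<Rightarrow> 'w \<Rightarrow> real^'n^'n" and w :: "nat \<Rightarrow> 'w \<Rightarrow> real^'n"
  assumes A: "posdef A" and M: "prob_space M"
    and rd: "random_directions M (\<lambda>\<omega>. (G 0 \<omega>, K 0 \<omega>)) w"
    and inv: "\<And>k \<omega>. \<omega> \<in> space M \<Longrightarrow> bfgs_invariant A (G k \<omega>) (K k \<omega>)"
    and G: "\<And>k \<omega>. \<omega> \<in> space M \<Longrightarrow> G (Suc k) \<omega> = BFGS (G k \<omega>) A (transpose (K k \<omega>) *v w k \<omega>)"
    and K: "\<And>k \<omega>. \<omega> \<in> space M \<Longrightarrow>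
      K (Suc k) \<omega> = BFGS_factor (K k \<omega>) A (transpose (K k \<omega>) *v w k \<omega>) (w k \<omega>)"
    and int0: "integrable M (\<lambda>\<omega>. bfgs_gap A (G 0 \<omega>))"
  shows "integrable M (\<lambda>\<omega>. bfgs_gap A (G k \<omega>)) \<and> (\<integral>\<omega>. bfgs_gap A (G k \<omega>) \<partial>M)
      = (1 - 1 / real CARD('n)) ^ k * (\<integral>\<omega>. bfgs_gap A (G 0 \<omega>) \<partial>M)"
proof -
  interpret prob_space M by (rule M)
  let ?H = "\<lambda>\<omega>. (G 0 \<omega>, K 0 \<omega>)" and ?d = "real CARD('n)"
  have past: "G j \<in> borel_measurable (past_algebra M ?H w k) \<and>
      K j \<in> borel_measurable (past_algebra M ?H w k)" if "j \<le> k" for j k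
    using that
  proof (induction j)
    case 0
    have "fst \<in> borel_measurable (borel :: ((real^'n^'n) \<times> (real^'n^'n)) measure)"
      "snd \<in> borel_measurable (borel :: ((real^'n^'n) \<times> (real^'n^'n)) measure)"
      by (intro borel_measurable_continuous_onI continuous_intros)+
    from this[THEN measurable_compose[OF measurable_past_initial[of ?H M w k]]]
    show ?case by simp
  next
    case (Suc j)
    then have [measurable]: "G j \<in> borel_measurable (past_algebra M ?H w k)"
      "K j \<in> borel_measurable (past_algebra M ?H w k)"
      "w j \<in> borel_measurable (past_algebra M ?H w k)"
      by (auto intro: measurable_past_direction)
    have "(\<lambda>\<omega>. BFGS (G j \<omega>) A (transpose (K j \<omega>) *v w j \<omega>))
        \<in> borel_measurable (past_algebra M ?H w k)"
      "(\<lambda>\<omega>. BFGS_factor (K j \<omega>) A (transpose (K j \<omega>) *v w j \<omega>) (w j \<omega>))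
        \<in> borel_measurable (past_algebra M ?H w k)"
      by measurable
    then show ?case
      by (subst (1) measurable_cong[OF G], simp, subst (1) measurable_cong[OF K]) simp_all
  qed
  define Q where "Q k \<omega> = bfgs_form A (G k \<omega>) (K k \<omega>)" for k \<omega>
  have Qpast: "Q k \<in> borel_measurable (past_algebra M ?H w k)" for k
  proof -
    have [measurable]: "G k \<in> borel_measurable (past_algebra M ?H w k)"
      "K k \<in> borel_measurable (past_algebra M ?H w k)"
      using past[of k k] by auto
    show ?thesis unfolding Q_def bfgs_form_def by measurable
  qed
  have [measurable]: "Q k \<in> borel_measurable M" "w k \<in> borel_measurable M" for k
    using measurable_past_algebra[OF rd Qpast[of k]] rd by (auto simp: random_directions_def)
  have psd: "psd (Q k \<omega>)" and trQ: "trace (Q k \<omega>) = bfgs_gap A (G k \<omega>) + ?d"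
    if "\<omega> \<in> space M" for k \<omega>
    unfolding Q_def
    using psd_bfgs_form[OF A inv[OF that]] trace_bfgs_form_gap[OF A inv[OF that]] by auto
  define f :: "(real^'n^'n) \<times> (real^'n) \<Rightarrow> real" where
    "f z = (snd z \<bullet> (fst z *v snd z)) / (snd z \<bullet> snd z)" for z
  have f [measurable]: "f \<in> borel_measurable (borel \<Otimes>\<^sub>M borel)"
    unfolding f_def by measurable
  have unit: "AE \<omega> in M. norm (w k \<omega>) = 1" for k
  proof -
    have "distr M borel (w k) = unif_sphere"
      using rd by (auto simp: random_directions_def)
    then have "AE s in distr M borel (w k). norm s = 1"
      by (simp only: AE_unif_sphere)
    then show ?thesis by (subst (asm) AE_distr_iff) auto
  qed
  \<comment> \<open>Only almost everywhere: at \<open>w k \<omega> = 0\<close> the update leaves the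
    gap unchanged, whereas the right-hand side adds 1.\<close>
  have step: "AE \<omega> in M. bfgs_gap A (G (Suc k) \<omega>) = bfgs_gap A (G k \<omega>) + 1 - f (Q k \<omega>, w k \<omega>)" for k
    using unit[of k] AE_space
  proof eventually_elim
    case (elim \<omega>)
    then show ?case
      by (simp add: G bfgs_gap_step[OF A inv] f_def Q_def dot_square_norm)
  qed
  show ?thesis
  proof (induction k)
    case (Suc k)
    then have int: "integrable M (\<lambda>\<omega>. bfgs_gap A (G k \<omega>))" by blast
    \<comment> \<open>The trace dominates the Rayleigh quotient \<open>f\<close>.\<close>
    have "integrable M (\<lambda>\<omega>. trace (Q k \<omega>))"
      using Bochner_Integration.integrable_add[OF int integrable_const[of ?d]]
      by (subst Bochner_Integration.integrable_cong[OF refl trQ]) simp_all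
    then have intf: "integrable M (\<lambda>\<omega>. f (Q k \<omega>, w k \<omega>))"
    proof (rule Bochner_Integration.integrable_bound)
      show "AE \<omega> in M. norm (f (Q k \<omega>, w k \<omega>)) \<le> norm (trace (Q k \<omega>))"
        using unit[of k] AE_space
      proof eventually_elim
        case (elim \<omega>)
        then show ?case
          using psd_quadratic_le_trace[OF psd, of \<omega> "w k \<omega>" k]
          by (simp add: f_def dot_square_norm psd_nonneg psd psd_trace_nonneg)
      qed
    qed measurable
    have sQ: "transpose (Q k \<omega>) = Q k \<omega>" if "\<omega> \<in> space M" for \<omega>
      by (rule psd_transpose[OF psd[OF that]])
    have "(\<integral>\<omega>. f (Q k \<omega>, w k \<omega>) \<partial>M) = (\<integral>\<omega>. (\<integral>s. f (Q k \<omega>, s) \<partial>unif_sphere) \<partial>M)"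
      by (rule expectation_freeze_past[OF M rd Qpast f intf])
    also have "\<dots> = (\<integral>\<omega>. bfgs_gap A (G k \<omega>) / ?d + 1 \<partial>M)"
      by (intro Bochner_Integration.integral_cong refl)
        (simp add: f_def sphere_rayleigh_mean sQ trQ add_divide_distrib)
    also have "\<dots> = (\<integral>\<omega>. bfgs_gap A (G k \<omega>) \<partial>M) / ?d + 1"
      using int by (simp add: prob_space)
    finally have mean: "(\<integral>\<omega>. f (Q k \<omega>, w k \<omega>) \<partial>M) = (\<integral>\<omega>. bfgs_gap A (G k \<omega>) \<partial>M) / ?d + 1" .
    have [measurable]: "G (Suc k) \<in> borel_measurable M"
      using measurable_past_algebra[OF rd conjunct1[OF past[of "Suc k" "Suc k"]]] by simp
    have meas: "(\<lambda>\<omega>. bfgs_gap A (G (Suc k) \<omega>)) \<in> borel_measurable M"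
      unfolding bfgs_gap_def by measurable
    have "integrable M (\<lambda>\<omega>. bfgs_gap A (G k \<omega>) + 1 - f (Q k \<omega>, w k \<omega>))"
      using int intf by simp
    then have "integrable M (\<lambda>\<omega>. bfgs_gap A (G (Suc k) \<omega>))"
      using integrable_cong_AE[OF meas _ step[of k]] by (simp add: borel_measurable_integrable)
    moreover have "(\<integral>\<omega>. bfgs_gap A (G (Suc k) \<omega>) \<partial>M)
        = (\<integral>\<omega>. bfgs_gap A (G k \<omega>) + 1 - f (Q k \<omega>, w k \<omega>) \<partial>M)"
      using int intf by (intro integral_cong_AE meas step) (auto intro: borel_measurable_integrable)
    moreover have "\<dots> = (1 - 1 / ?d) * (\<integral>\<omega>. bfgs_gap A (G k \<omega>) \<partial>M)"
      using int intf mean by (simp add: prob_space algebra_simps)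
    ultimately show ?case using Suc by simp
  qed (simp add: int0)
qed

text \<open>Inversion reverses the Loewner order, so the inverse of \<open>A\<close> lies below
  \<open>mat (1 / \<mu>)\<close>; pairing with \<open>R\<close> preserves this. It bounds the
  initial BFGS gap by an integrable trace.\<close>

lemma trace_mul_inverse_le:
  fixes A R :: "real^'n^'n"
  assumes sym: "transpose A = A" and \<mu>: "0 < \<mu>" "mat \<mu> \<preceq> A" and R: "psd R"
  shows "trace (R ** matrix_inv A) \<le> trace R / \<mu>"
proof -
  note A = posdef_of_loewner[OF sym \<mu>]
  have mat: "(mat (1 / \<mu>) :: real^'n^'n) = (1 / \<mu>) *\<^sub>R mat 1"
    by (simp add: mat_def vec_eq_iff)
  have "psd (mat (1 / \<mu>) - matrix_inv A)"
    unfolding psd_def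
  proof safe
    show "transpose (mat (1 / \<mu>) - matrix_inv A) = mat (1 / \<mu>) - matrix_inv A"
      by (simp add: transpose_diff transpose_mat psd_transpose[OF psd_matrix_inv[OF A(1)]])
    fix v
    define p where "p = matrix_inv A *v v"
    have v: "v = A *v p" by (simp add: p_def posdef_inverse[OF A(1)])
    let ?s = "p \<bullet> (A *v p)"
    have s0: "0 \<le> ?s" by (rule psd_nonneg[OF posdef_psd[OF A(1)]])
    \<comment> \<open>One factor \<open>?s\<close> is cancelled at the end, after
      \<open>p \<bullet> p\<close> is replaced by its upper bound \<open>?s / \<mu>\<close>.\<close>
    have "?s\<^sup>2 \<le> (p \<bullet> p) * (v \<bullet> v)"
      using Cauchy_Schwarz_ineq[of p v] by (simp add: v)
    also have "\<dots> \<le> (?s / \<mu>) * (v \<bullet> v)"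
      using A(2)[of p] \<mu>(1) by (intro mult_right_mono) (auto simp: le_divide_eq mult.commute)
    finally have le: "?s * ?s \<le> ?s * ((v \<bullet> v) / \<mu>)"
      by (simp add: power2_eq_square)
    have "?s \<le> (v \<bullet> v) / \<mu>"
    proof (cases "?s = 0")
      case False
      then show ?thesis using mult_left_le_imp_le[OF le] s0 by simp
    qed (use \<mu>(1) in simp)
    then show "0 \<le> v \<bullet> ((mat (1 / \<mu>) - matrix_inv A) *v v)"
      by (simp add: matrix_vector_mult_diff_rdistrib inner_diff_right mat
          scaleR_matrix_vector_assoc[symmetric] inner_commute flip: p_def v)
  qed
  from trace_mul_psd_nonneg[OF this R] show ?thesis
    by (simp add: matrix_mul_diff_ldistrib trace_sub mat matrix_mul_scaleR trace_scaleR)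
qed

text \<open>The contraction of the decrement is derived on every sample path; the law of the
  directions enters only through the expectation bounds.\<close>

theorem theorem17:
  fixes A :: "real^'n^'n" and b x0 :: "real^'n" and \<mu> L :: real
    and M :: "'w measure"
    and x u w :: "nat \<Rightarrow> 'w \<Rightarrow> real^'n"
    and G K :: "nat \<Rightarrow> 'w \<Rightarrow> real^'n^'n"
  assumes "transpose A = A" and "\<mu> > 0" and "L > 0"
    and "mat \<mu> \<preceq> A" and "A \<preceq> mat L"
    and "prob_space M"
    and "G 0 \<in> borel_measurable M"
    and "\<forall>\<omega>\<in>space M. transpose (G 0 \<omega>) = G 0 \<omega> \<and> A \<preceq> G 0 \<omega>"
    and "integrable M (\<lambda>\<omega>. trace (G 0 \<omega>))"
  shows
   "((\<forall>\<omega>\<in>space M. SR1_run (quadratic A b) A x0 (\<lambda>k. x k \<omega>) (\<lambda>k. G k \<omega>) (\<lambda>k. u k \<omega>)) \<and>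
     ((\<forall>\<omega>\<in>space M. \<forall>k. greedy_direction (G k \<omega> - A) (u k \<omega>)) \<or>
      random_directions M (G 0) u)
     \<longrightarrow> (\<exists>\<rho> :: nat \<Rightarrow> 'w \<Rightarrow> real. \<forall>k.
           integrable M (\<rho> k) \<and>
           (\<forall>\<omega>\<in>space M. 0 \<le> \<rho> k \<omega> \<and>
              newton_decrement (quadratic A b) A (x (Suc k) \<omega>)
                \<le> \<rho> k \<omega> * newton_decrement (quadratic A b) A (x k \<omega>)) \<and>
           (\<integral>\<omega>. \<rho> k \<omega> \<partial>M)
             \<le> max 0 (1 - real k / real CARD('n)) * (\<integral>\<omega>. trace (G 0 \<omega> - A) \<partial>M) / \<mu>))
    \<and>
    ((\<forall>\<omega>\<in>space M. BFGS_run (quadratic A b) A x0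
         (\<lambda>k. x k \<omega>) (\<lambda>k. G k \<omega>) (\<lambda>k. K k \<omega>) (\<lambda>k. u k \<omega>) (\<lambda>k. w k \<omega>)) \<and>
     ((\<forall>\<omega>\<in>space M. \<forall>k. greedy_direction
          (transpose (matrix_inv (K k \<omega>)) ** matrix_inv A ** matrix_inv (K k \<omega>)) (w k \<omega>)) \<or>
      random_directions M (\<lambda>\<omega>. (G 0 \<omega>, K 0 \<omega>)) w)
     \<longrightarrow> (\<exists>\<rho> :: nat \<Rightarrow> 'w \<Rightarrow> real. \<forall>k.
           integrable M (\<rho> k) \<and>
           (\<forall>\<omega>\<in>space M. 0 \<le> \<rho> k \<omega> \<and>
              newton_decrement (quadratic A b) A (x (Suc k) \<omega>)
                \<le> \<rho> k \<omega> * newton_decrement (quadratic A b) A (x k \<omega>)) \<and>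
           (\<integral>\<omega>. \<rho> k \<omega> \<partial>M)
             \<le> (1 - 1 / real CARD('n)) ^ k
                * (\<integral>\<omega>. trace (G 0 \<omega> ** matrix_inv A) - real CARD('n) \<partial>M)))"
proof -
  interpret prob_space M by fact
  let ?d = "real CARD('n)" and ?nd = "newton_decrement (quadratic A b) A"
  note A = posdef_of_loewner[OF assms(1,2,4)]
  have psd0: "psd (G 0 \<omega> - A)" if "\<omega> \<in> space M" for \<omega>
    using assms(8) that by (simp add: loewner_le_def)
  have int_tr: "integrable M (\<lambda>\<omega>. trace (G 0 \<omega> - A))"
    using assms(9) by (simp add: trace_sub)
  note [measurable] = assms(7)
  have int_gap: "integrable M (\<lambda>\<omega>. bfgs_gap A (G 0 \<omega>))"
  proof (rule Bochner_Integration.integrable_bound)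
    show "integrable M (\<lambda>\<omega>. trace (G 0 \<omega> - A) / \<mu>)" using int_tr by simp
    show "(\<lambda>\<omega>. bfgs_gap A (G 0 \<omega>)) \<in> borel_measurable M"
      unfolding bfgs_gap_def by measurable
    show "AE \<omega> in M. norm (bfgs_gap A (G 0 \<omega>)) \<le> norm (trace (G 0 \<omega> - A) / \<mu>)"
    proof (rule AE_I2)
      fix \<omega> assume "\<omega> \<in> space M"
      from psd0[OF this] show "norm (bfgs_gap A (G 0 \<omega>)) \<le> norm (trace (G 0 \<omega> - A) / \<mu>)"
        using trace_mul_inverse_le[OF assms(1,2,4) psd0[OF \<open>\<omega> \<in> space M\<close>]] assms(2)
        by (simp add: bfgs_gap_nonneg[OF A(1)] psd_trace_nonneg) (simp add: bfgs_gap_eq[OF A(1)])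
    qed
  qed
  have sr1: "\<exists>\<rho> :: nat \<Rightarrow> 'w \<Rightarrow> real. \<forall>k. integrable M (\<rho> k) \<and>
      (\<forall>\<omega>\<in>space M. 0 \<le> \<rho> k \<omega> \<and> ?nd (x (Suc k) \<omega>) \<le> \<rho> k \<omega> * ?nd (x k \<omega>)) \<and>
      (\<integral>\<omega>. \<rho> k \<omega> \<partial>M) \<le> max 0 (1 - real k / ?d) * (\<integral>\<omega>. trace (G 0 \<omega> - A) \<partial>M) / \<mu>"
    if run: "\<forall>\<omega>\<in>space M. SR1_run (quadratic A b) A x0 (\<lambda>k. x k \<omega>) (\<lambda>k. G k \<omega>) (\<lambda>k. u k \<omega>)"
      and dir: "(\<forall>\<omega>\<in>space M. \<forall>k. greedy_direction (G k \<omega> - A) (u k \<omega>)) \<or> random_directions M (G 0) u"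
  proof -
    define R where "R k \<omega> = G k \<omega> - A" for k \<omega>
    have psd: "psd (R k \<omega>)" if "\<omega> \<in> space M" for k \<omega>
    proof (induction k)
      case (Suc k)
      then show ?case
        using run that by (simp add: R_def SR1_run_def SR1_diff psd_deflate)
    qed (simp add: R_def psd0[OF that])
    have step: "R (Suc k) \<omega> = deflate (R k \<omega>) (u k \<omega>)" if "\<omega> \<in> space M" for k \<omega>
      using run that SR1_diff psd[OF that, of k] by (simp add: R_def SR1_run_def)
    \<comment> \<open>Any upper bound of \<open>trace (R k \<omega>) / \<mu>\<close> is allowed, so
      that the greedy and the random choice of \<rho> are both covered.\<close>
    have newton: "?nd (x (Suc k) \<omega>) \<le> \<rho> * ?nd (x k \<omega>)"
      if \<omega>: "\<omega> \<in> space M" and \<rho>: "trace (R k \<omega>) / \<mu> \<le> \<rho>" for k \<omega> \<rho>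
    proof (rule newton_decrement_step[OF A(1)])
      have tr: "0 \<le> trace (R k \<omega>)" by (rule psd_trace_nonneg[OF psd[OF \<omega>]])
      show "psd (G k \<omega> - A)" using psd[OF \<omega>, of k] by (simp add: R_def)
      have "0 \<le> trace (R k \<omega>) / \<mu>" using tr assms(2) by simp
      then show \<rho>0: "0 \<le> \<rho>" using \<rho> by linarith
      show "x (Suc k) \<omega> = x k \<omega> - matrix_inv (G k \<omega>) *v gradient (quadratic A b) (x k \<omega>)"
        using run \<omega> by (simp add: SR1_run_def)
      fix v
      \<comment> \<open>The factor \<mu> is inserted so that \<open>\<mu> * (v \<bullet> v)\<close>
        can be replaced by the form of \<open>A\<close>.\<close>
      have "v \<bullet> (R k \<omega> *v v) \<le> trace (R k \<omega>) / \<mu> * (\<mu> * (v \<bullet> v))"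
        using psd_quadratic_le_trace[OF psd[OF \<omega>], of v k] assms(2) by simp
      also have "\<dots> \<le> \<rho> * (v \<bullet> (A *v v))"
        using A(2)[of v] tr \<rho> assms(2) \<rho>0 by (intro mult_mono) auto
      finally show "v \<bullet> ((G k \<omega> - A) *v v) \<le> \<rho> * (v \<bullet> (A *v v))" by (simp add: R_def)
    qed
    have nn: "0 \<le> trace (R k \<omega>)" if "\<omega> \<in> space M" for k \<omega>
      by (rule psd_trace_nonneg[OF psd[OF that]])
    have int0: "integrable M (\<lambda>\<omega>. trace (R 0 \<omega>))" using int_tr by (simp add: R_def)
    show ?thesis
      using dir
    proof
      assume greedy: "\<forall>\<omega>\<in>space M. \<forall>k. greedy_direction (G k \<omega> - A) (u k \<omega>)"
      define \<rho> where "\<rho> k \<omega> = max 0 (1 - real k / ?d) * trace (R 0 \<omega>) / \<mu>" for k \<omega>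
      have \<rho>: "trace (R k \<omega>) / \<mu> \<le> \<rho> k \<omega>" if "\<omega> \<in> space M" for k \<omega>
        unfolding \<rho>_def
        by (intro divide_right_mono greedy_SR1_decay[where u = "\<lambda>k. u k \<omega>"])
          (use that greedy psd step assms(2) in \<open>auto simp: R_def\<close>)
      show ?thesis
      proof (intro exI[of _ \<rho>] allI conjI ballI)
        show "integrable M (\<rho> k)" for k
          using int0 unfolding \<rho>_def[abs_def] by simp
        show "0 \<le> \<rho> k \<omega>" "?nd (x (Suc k) \<omega>) \<le> \<rho> k \<omega> * ?nd (x k \<omega>)" if "\<omega> \<in> space M" for k \<omega>
          using newton[OF that \<rho>[OF that]] nn[OF that] assms(2) by (simp_all add: \<rho>_def)
        show "(\<integral>\<omega>. \<rho> k \<omega> \<partial>M) \<le> max 0 (1 - real k / ?d) * (\<integral>\<omega>. trace (G 0 \<omega> - A) \<partial>M) / \<mu>" for k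
          by (simp add: \<rho>_def R_def)
      qed
    next
      assume rd: "random_directions M (G 0) u"
      \<comment> \<open>Here the iterates are measurable, so the current trace itself can serve as
        the contraction factor.\<close>
      define \<rho> where "\<rho> k \<omega> = trace (R k \<omega>) / \<mu>" for k \<omega>
      have "R 0 \<in> borel_measurable (past_algebra M (G 0) u k)" for k
        unfolding R_def using measurable_past_initial[of "G 0" M u k] by measurable
      note decay = random_SR1_decay[OF assms(6) rd this psd step int0]
      show ?thesis
      proof (intro exI[of _ \<rho>] allI conjI ballI)
        show "integrable M (\<rho> k)" for k
          using decay(1) unfolding \<rho>_def[abs_def] by simp
        show "0 \<le> \<rho> k \<omega>" "?nd (x (Suc k) \<omega>) \<le> \<rho> k \<omega> * ?nd (x k \<omega>)" if "\<omega> \<in> space M" for k \<omega>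
          using newton[OF that order_refl] nn[OF that] assms(2) by (simp_all add: \<rho>_def)
        show "(\<integral>\<omega>. \<rho> k \<omega> \<partial>M) \<le> max 0 (1 - real k / ?d) * (\<integral>\<omega>. trace (G 0 \<omega> - A) \<partial>M) / \<mu>" for k
          using divide_right_mono[OF decay(2), of \<mu> k] assms(2) by (simp add: \<rho>_def R_def)
      qed
    qed
  qed
  have bfgs: "\<exists>\<rho> :: nat \<Rightarrow> 'w \<Rightarrow> real. \<forall>k. integrable M (\<rho> k) \<and>
      (\<forall>\<omega>\<in>space M. 0 \<le> \<rho> k \<omega> \<and> ?nd (x (Suc k) \<omega>) \<le> \<rho> k \<omega> * ?nd (x k \<omega>)) \<and>
      (\<integral>\<omega>. \<rho> k \<omega> \<partial>M) \<le> (1 - 1 / ?d) ^ k * (\<integral>\<omega>. bfgs_gap A (G 0 \<omega>) \<partial>M)"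
    if run: "\<forall>\<omega>\<in>space M. BFGS_run (quadratic A b) A x0
         (\<lambda>k. x k \<omega>) (\<lambda>k. G k \<omega>) (\<lambda>k. K k \<omega>) (\<lambda>k. u k \<omega>) (\<lambda>k. w k \<omega>)"
      and dir: "(\<forall>\<omega>\<in>space M. \<forall>k. greedy_direction
          (transpose (matrix_inv (K k \<omega>)) ** matrix_inv A ** matrix_inv (K k \<omega>)) (w k \<omega>)) \<or>
        random_directions M (\<lambda>\<omega>. (G 0 \<omega>, K 0 \<omega>)) w"
  proof -
    have G: "G (Suc k) \<omega> = BFGS (G k \<omega>) A (transpose (K k \<omega>) *v w k \<omega>)"
      and K: "K (Suc k) \<omega> = BFGS_factor (K k \<omega>) A (transpose (K k \<omega>) *v w k \<omega>) (w k \<omega>)"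
      if "\<omega> \<in> space M" for k \<omega>
      using run that by (simp_all add: BFGS_run_def)
    have inv: "bfgs_invariant A (G k \<omega>) (K k \<omega>)" if "\<omega> \<in> space M" for k \<omega>
    proof (induction k)
      case 0
      then show ?case using run that psd0[OF that] by (simp add: BFGS_run_def bfgs_invariant_def)
    next
      case (Suc k)
      then show ?case by (simp add: G[OF that] K[OF that] bfgs_invariant_step[OF A(1)])
    qed
    have psd: "psd (G k \<omega> - A)" if "\<omega> \<in> space M" for k \<omega>
      using inv[OF that] by (simp add: bfgs_invariant_def)
    note nn = bfgs_gap_nonneg[OF A(1) psd]
    have newton: "?nd (x (Suc k) \<omega>) \<le> \<rho> * ?nd (x k \<omega>)"
      if \<omega>: "\<omega> \<in> space M" and \<rho>: "bfgs_gap A (G k \<omega>) \<le> \<rho>" for k \<omega> \<rho>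
    proof (rule newton_decrement_step[OF A(1) psd[OF \<omega>]])
      show "0 \<le> \<rho>" using nn[OF \<omega>, of k] \<rho> by linarith
      show "x (Suc k) \<omega> = x k \<omega> - matrix_inv (G k \<omega>) *v gradient (quadratic A b) (x k \<omega>)"
        using run \<omega> by (simp add: BFGS_run_def)
      fix v
      have "v \<bullet> ((G k \<omega> - A) *v v) \<le> bfgs_gap A (G k \<omega>) * (v \<bullet> (A *v v))"
        unfolding bfgs_gap_eq[OF A(1)] by (rule quadratic_form_le_trace[OF A(1) psd[OF \<omega>]])
      also have "\<dots> \<le> \<rho> * (v \<bullet> (A *v v))"
        by (intro mult_right_mono \<rho> psd_nonneg[OF posdef_psd[OF A(1)]])
      finally show "v \<bullet> ((G k \<omega> - A) *v v) \<le> \<rho> * (v \<bullet> (A *v v))" .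
    qed
    have d: "1 \<le> ?d" by (simp add: Suc_leI)
    show ?thesis
      using dir
    proof
      assume greedy: "\<forall>\<omega>\<in>space M. \<forall>k. greedy_direction
          (transpose (matrix_inv (K k \<omega>)) ** matrix_inv A ** matrix_inv (K k \<omega>)) (w k \<omega>)"
      define \<rho> where "\<rho> k \<omega> = (1 - 1 / ?d) ^ k * bfgs_gap A (G 0 \<omega>)" for k \<omega>
      have \<rho>: "bfgs_gap A (G k \<omega>) \<le> \<rho> k \<omega>" if "\<omega> \<in> space M" for k \<omega>
        unfolding \<rho>_def
      proof (rule greedy_BFGS_decay[where G = "\<lambda>k. G k \<omega>" and K = "\<lambda>k. K k \<omega>" and w = "\<lambda>k. w k \<omega>",
            OF A(1) inv[OF that] G[OF that]])
        \<comment> \<open>The invariant identifies the matrix in the greedy rule with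
          \<open>bfgs_form\<close>.\<close>
        show "greedy_direction (bfgs_form A (G k \<omega>) (K k \<omega>)) (w k \<omega>)" for k
          using greedy that unfolding bfgs_form_eq[OF A(1) inv[OF that], symmetric] by blast
      qed
      show ?thesis
      proof (intro exI[of _ \<rho>] allI conjI ballI)
        show "integrable M (\<rho> k)" for k
          using int_gap unfolding \<rho>_def[abs_def] by simp
        show "0 \<le> \<rho> k \<omega>" "?nd (x (Suc k) \<omega>) \<le> \<rho> k \<omega> * ?nd (x k \<omega>)" if "\<omega> \<in> space M" for k \<omega>
          using newton[OF that \<rho>[OF that]] order_trans[OF nn[OF that] \<rho>[OF that]] by simp_all
      qed (simp add: \<rho>_def)
    next
      assume rd: "random_directions M (\<lambda>\<omega>. (G 0 \<omega>, K 0 \<omega>)) w"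
      note decay = random_BFGS_decay[where G = G and K = K and w = w,
          OF A(1) assms(6) rd inv G K int_gap]
      show ?thesis
      proof (intro exI[of _ "\<lambda>k \<omega>. bfgs_gap A (G k \<omega>)"] allI conjI ballI)
        show "integrable M (\<lambda>\<omega>. bfgs_gap A (G k \<omega>))" for k
          using decay by blast
        show "(\<integral>\<omega>. bfgs_gap A (G k \<omega>) \<partial>M) \<le> (1 - 1 / ?d) ^ k * (\<integral>\<omega>. bfgs_gap A (G 0 \<omega>) \<partial>M)" for k
          using decay[of k] by linarith
      qed (auto intro: nn newton)
    qed
  qed
  show ?thesis
    using sr1 bfgs by (intro conjI impI; elim conjE) (simp_all only: bfgs_gap_def)
qed

end
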